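(* Let $n$ be a positive integer, let $h:[n]\to\{0,1,\dots,n-1\}$ be any nondecreasing function with $h(i)<i$ for all $i\in[n]$, and let $\lambda$ be any weak composition of $n$. Then the Hessenberg variety $\mathrm{Hess}(X_\lambda,h)$ is connected whenever it is nonempty.
   Context: $[n]=\{1,\dots,n\}$. $\mathrm{Flags}(\mathbb{C}^n)$ is the variety of full flags $V_\bullet=(V_1\subset\cdots\subset V_n=\mathbb{C}^n)$ with $\dim V_i=i$; set $V_0=\{0\}$. For $X\in\mathfrak{gl}_n(\mathbb{C})$, $\mathrm{Hess}(X,h)=\{V_\bullet\in\mathrm{Flags}(\mathbb{C}^n): X(V_i)\subseteq V_{h(i)}\ \text{for all } i\in[n]\}$. A weak composition $\lambda$ of $n$ (a finite sequence of nonnegative integers with sum $n$) is drawn as a left-justified diagram whose $i$-th row from the top has $\lambda_i$ boxes. Its base filling labels the boxes by $1,\dots,n$, column by column from the leftmost column to the right, and from bottom to top in each column. $X_\lambda=\sum E_{ab}$, summed over all pairs $(a,b)$ such that $b$ labels the box directly to the right of the box labeled $a$ in the base filling, where $E_{ab}$ is the elementary matrix with a single nonzero entry $1$ in row $a$, column $b$. (So $X_\lambda$ is nilpotent with Jordan block sizes the nonzero parts of $\lambda$.) *)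

theory Defs
  imports "HOL-Analysis.Analysis" "HOL-Library.Function_Algebras"
begin

text \<open>Vectors of \<open>\<complex>\<^sup>n\<close> are functions \<^typ>\<open>nat \<Rightarrow> complex\<close> that vanish off the index set
  \<open>[n] = {1..n}\<close>, and \<open>n \<times> n\<close> matrices are functions \<^typ>\<open>nat \<Rightarrow> nat \<Rightarrow> complex\<close> of which only the
  entries with row and column in \<open>[n]\<close> matter. The size \<open>n\<close> is thus an ordinary number, and
  indices start at 1.\<close>

abbreviation cscale :: "complex \<Rightarrow> (nat \<Rightarrow> complex) \<Rightarrow> nat \<Rightarrow> complex" where
  "cscale c v \<equiv> (\<lambda>k. c * v k)"

interpretation cvec: vector_space cscale
  by unfold_locales (auto simp: algebra_simps)

definition cspace :: "nat \<Rightarrow> (nat \<Rightarrow> complex) set" where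
  "cspace n = {v. \<forall>k. k \<notin> {1..n} \<longrightarrow> v k = 0}"

definition mat_vec :: "nat \<Rightarrow> (nat \<Rightarrow> nat \<Rightarrow> complex) \<Rightarrow> (nat \<Rightarrow> complex) \<Rightarrow> nat \<Rightarrow> complex" where
  "mat_vec n X v = (\<lambda>i. if i \<in> {1..n} then \<Sum>j\<in>{1..n}. X i j * v j else 0)"

text \<open>A full flag is a function \<open>V\<close> on \<open>{0..n}\<close>; extensionality makes its values outside
  \<open>{0..n}\<close> irrelevant, so that every flag is represented exactly once.\<close>

definition flags :: "nat \<Rightarrow> (nat \<Rightarrow> (nat \<Rightarrow> complex) set) set" where
  "flags n = {V \<in> extensional {0..n}.
     V 0 = {0} \<and> V n = cspace n \<and>
     (\<forall>i\<in>{1..n}. cvec.subspace (V i) \<and> cvec.dim (V i) = i) \<and>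
     (\<forall>i\<in>{1..<n}. V i \<subseteq> V (Suc i))}"

text \<open>The topology on \<^term>\<open>flags n\<close> is the classical one, i.e. the quotient topology of
  \<open>GL\<^sub>n(\<complex>) / B\<close>. An element of \<open>GL\<^sub>n(\<complex>)\<close> is given by its columns \<open>f 1, \<dots>, f n\<close> (a frame), and \<open>frames n\<close>
  carries the subspace topology of the entrywise topology. The frame \<open>f\<close> is sent to
  the flag with \<open>V i = span {f 1, \<dots>, f i}\<close>.\<close>

definition frames :: "nat \<Rightarrow> (nat \<Rightarrow> nat \<Rightarrow> complex) set" where
  "frames n = {f. (\<forall>k\<in>{1..n}. f k \<in> cspace n) \<and> (\<forall>k. k \<notin> {1..n} \<longrightarrow> f k = 0) \<and>
     inj_on f {1..n} \<and> cvec.independent (f ` {1..n})}"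

definition flag_of :: "nat \<Rightarrow> (nat \<Rightarrow> nat \<Rightarrow> complex) \<Rightarrow> nat \<Rightarrow> (nat \<Rightarrow> complex) set" where
  "flag_of n f = (\<lambda>i\<in>{0..n}. cvec.span (f ` {1..i}))"

definition flag_topology :: "nat \<Rightarrow> (nat \<Rightarrow> (nat \<Rightarrow> complex) set) topology" where
  "flag_topology n = topology (\<lambda>U. U \<subseteq> flags n \<and>
     openin (top_of_set (frames n)) {f \<in> frames n. flag_of n f \<in> U})"

lemma openin_flag_topology:
  "openin (flag_topology n) U \<longleftrightarrow>
     U \<subseteq> flags n \<and> openin (top_of_set (frames n)) {f \<in> frames n. flag_of n f \<in> U}"
proof -
  have 1: "{f \<in> frames n. flag_of n f \<in> S \<inter> T} =
      {f \<in> frames n. flag_of n f \<in> S} \<inter> {f \<in> frames n. flag_of n f \<in> T}" for S T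
    by auto
  have 2: "{f \<in> frames n. flag_of n f \<in> \<Union>\<K>} = (\<Union>S\<in>\<K>. {f \<in> frames n. flag_of n f \<in> S})" for \<K>
    by auto
  have "istopology (\<lambda>U. U \<subseteq> flags n \<and>
     openin (top_of_set (frames n)) {f \<in> frames n. flag_of n f \<in> U})"
    unfolding istopology_def 1 2 by (auto intro!: openin_Int openin_Union)
  then show ?thesis
    by (simp add: flag_topology_def topology_inverse')
qed

lemma sum_fun_apply: "(\<Sum>k\<in>A. g k) j = (\<Sum>k\<in>A. g k j :: 'b :: comm_monoid_add)"
  by (induction A rule: infinite_finite_induct) auto

lemma flag_of_in_flags:
  assumes f: "f \<in> frames n"
  shows "flag_of n f \<in> flags n"
proof -
  have inj: "inj_on f {1..n}" and ind: "cvec.independent (f ` {1..n})"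
    and mem: "\<And>k. k \<in> {1..n} \<Longrightarrow> f k \<in> cspace n"
    using f by (auto simp: frames_def)
  have dim: "cvec.dim (cvec.span (f ` {1..i})) = i" if "i \<le> n" for i
  proof -
    have "cvec.independent (f ` {1..i})"
      using ind that by (rule_tac cvec.independent_mono) auto
    moreover have "card (f ` {1..i}) = i"
      using inj_on_subset[OF inj, of "{1..i}"] that by (simp add: card_image)
    ultimately show ?thesis
      using cvec.dim_span_eq_card_independent by force
  qed
  define e where "e = (\<lambda>(k::nat) j. if j = k then 1 else (0::complex))"
  have sub: "cvec.subspace (cspace n)"
    by (auto simp: cvec.subspace_def cspace_def)
  have "v \<in> cvec.span (e ` {1..n})" if "v \<in> cspace n" for v
  proof -
    have "v = (\<Sum>k\<in>{1..n}. cscale (v k) (e k))"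
    proof
      fix j
      have "(\<Sum>k\<in>{1..n}. cscale (v k) (e k)) j = (\<Sum>k\<in>{1..n}. v k * e k j)"
        by (rule sum_fun_apply)
      also have "\<dots> = (\<Sum>k\<in>{1..n}. if j = k then v k else 0)"
        by (intro sum.cong) (auto simp: e_def)
      also have "\<dots> = v j"
        using that by (auto simp: cspace_def)
      finally show "v j = (\<Sum>k\<in>{1..n}. cscale (v k) (e k)) j" by simp
    qed
    also have "\<dots> \<in> cvec.span (e ` {1..n})"
      by (intro cvec.span_sum cvec.span_scale cvec.span_base) auto
    finally show ?thesis .
  qed
  then have e: "cspace n \<subseteq> cvec.span (e ` {1..n})" by blast
  have "cspace n \<subseteq> cvec.span (f ` {1..n})"
  proof
    fix v assume v: "v \<in> cspace n"
    show "v \<in> cvec.span (f ` {1..n})"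
    proof (rule ccontr)
      assume nv: "v \<notin> cvec.span (f ` {1..n})"
      then have "cvec.independent (insert v (f ` {1..n}))"
        using ind cvec.independent_insertI by blast
      moreover have "insert v (f ` {1..n}) \<subseteq> cvec.span (e ` {1..n})"
        using v mem e by blast
      ultimately have "card (insert v (f ` {1..n})) \<le> card (e ` {1..n})"
        using cvec.independent_span_bound[of "e ` {1..n}"] by simp
      moreover have "card (e ` {1..n}) \<le> n"
        using card_image_le[of "{1..n}" e] by simp
      moreover have "card (insert v (f ` {1..n})) = Suc n"
      proof -
        have "v \<notin> f ` {1..n}" using nv cvec.span_base by blast
        then show ?thesis using inj by (simp add: card_image)
      qed
      ultimately show False by simp
    qed
  qed
  moreover have "cvec.span (f ` {1..n}) \<subseteq> cspace n"
    using mem sub by (intro cvec.span_minimal) auto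
  ultimately have top: "cvec.span (f ` {1..n}) = cspace n" by blast
  have "cvec.span (f ` {1..i}) \<subseteq> cvec.span (f ` {1..Suc i})" for i
    by (intro cvec.span_mono image_mono) auto
  then show ?thesis
    using dim top by (auto simp: flags_def flag_of_def cvec.subspace_span)
qed

lemma topspace_flag_topology: "topspace (flag_topology n) = flags n"
proof -
  have "{f \<in> frames n. flag_of n f \<in> flags n} = frames n"
    using flag_of_in_flags by blast
  then have "openin (flag_topology n) (flags n)"
    by (simp add: openin_flag_topology)
  then show ?thesis
    by (metis openin_flag_topology openin_subset openin_topspace subset_antisym)
qed

definition Hess ::
  "nat \<Rightarrow> (nat \<Rightarrow> nat \<Rightarrow> complex) \<Rightarrow> (nat \<Rightarrow> nat) \<Rightarrow> (nat \<Rightarrow> (nat \<Rightarrow> complex) set) set" where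
  "Hess n X h = {V \<in> flags n. \<forall>i\<in>{1..n}. mat_vec n X ` V i \<subseteq> V (h i)}"

definition weak_composition :: "nat list \<Rightarrow> nat \<Rightarrow> bool" where
  "weak_composition lam n \<longleftrightarrow> sum_list lam = n"

text \<open>The box \<open>(r, c)\<close> lies in row \<open>r\<close> from the top and column \<open>c\<close> from the left, both counted
  from 0.\<close>

definition boxes :: "nat list \<Rightarrow> (nat \<times> nat) set" where
  "boxes lam = {(r, c). r < length lam \<and> c < lam ! r}"

text \<open>The label of a box in the base filling is its position (starting from 1) in the order that
  reads columns from left to right and each column from bottom to top, so it is the number of boxes
  up to and including it in this order.\<close>

definition base_label :: "nat list \<Rightarrow> nat \<times> nat \<Rightarrow> nat" where
  "base_label lam = (\<lambda>(r, c).
     card {(r', c') \<in> boxes lam. c' < c \<or> c' = c \<and> r \<le> r'})"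

definition elem_mat :: "nat \<Rightarrow> nat \<Rightarrow> nat \<Rightarrow> nat \<Rightarrow> complex" where
  "elem_mat a b = (\<lambda>i j. if i = a \<and> j = b then 1 else 0)"

definition adjacent_labels :: "nat list \<Rightarrow> (nat \<times> nat) set" where
  "adjacent_labels lam = {(base_label lam (r, c), base_label lam (r, Suc c)) | r c.
     (r, c) \<in> boxes lam \<and> (r, Suc c) \<in> boxes lam}"

definition X_mat :: "nat list \<Rightarrow> nat \<Rightarrow> nat \<Rightarrow> complex" where
  "X_mat lam = (\<lambda>i j. \<Sum>(a, b)\<in>adjacent_labels lam. elem_mat a b i j)"

lemma finite_boxes: "finite (boxes lam)"
  by (rule finite_subset[of _ "Sigma {..<length lam} (\<lambda>r. {..<lam ! r})"])
    (auto simp: boxes_def)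

lemma bij_betw_base_label:
  assumes "weak_composition lam n"
  shows "bij_betw (base_label lam) (boxes lam) {1..n}"
proof -
  define B where "B = (\<lambda>(r, c). {(r', c') \<in> boxes lam. c' < c \<or> c' = c \<and> r \<le> r'})"
  have lab: "base_label lam p = card (B p)" for p
    by (cases p) (simp add: base_label_def B_def)
  have fin: "finite (B p)" for p
    by (rule finite_subset[OF _ finite_boxes[of lam]]) (auto simp: B_def)
  have "boxes lam = Sigma {..<length lam} (\<lambda>r. {..<lam ! r})"
    by (auto simp: boxes_def)
  then have card: "card (boxes lam) = n"
    using assms by (simp add: weak_composition_def sum_list_sum_nth atLeast0LessThan)
  have less: "card (B p) < card (B q)"
    if "q \<in> boxes lam" "snd p < snd q \<or> snd p = snd q \<and> fst q < fst p" for p q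
  proof (rule psubset_card_mono[OF fin])
    have "q \<in> B q" "q \<notin> B p" "B p \<subseteq> B q"
      using that by (auto simp: B_def)
    then show "B p \<subset> B q" by blast
  qed
  have inj: "inj_on (base_label lam) (boxes lam)"
  proof (rule inj_onI)
    fix p q assume "p \<in> boxes lam" "q \<in> boxes lam" "base_label lam p = base_label lam q"
    then show "p = q"
      using less[of q p] less[of p q] by (metis lab less_irrefl linorder_neqE_nat prod_eqI)
  qed
  have "base_label lam ` boxes lam \<subseteq> {1..n}"
  proof
    fix k assume "k \<in> base_label lam ` boxes lam"
    then obtain p where p: "p \<in> boxes lam" "k = card (B p)" by (auto simp: lab)
    have "p \<in> B p" using p by (auto simp: B_def)
    then have "card (B p) \<noteq> 0" using fin by (metis card_0_eq empty_iff)
    moreover have "card (B p) \<le> n"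
      using card_mono[OF finite_boxes, of "B p" lam] card by (auto simp: B_def)
    ultimately show "k \<in> {1..n}" using p by simp
  qed
  then have "base_label lam ` boxes lam = {1..n}"
    using card inj by (intro card_subset_eq) (auto simp: card_image)
  with inj show ?thesis by (simp add: bij_betw_def)
qed

end

theory Submission
  imports Defs
begin

text \<open>
  Let the torus act on \<open>\<complex>\<^sup>n\<close> with weight \<open>r (n + 1) + c\<close> on the basis vector of the box \<open>(r, c)\<close>.
  The weights are distinct and \<open>X\<^sub>\<lambda>\<close> is homogeneous of degree \<open>-1\<close>, so the torus preserves the
  Hessenberg variety and its flow connects every flag to a coordinate flag of the variety. Such a
  coordinate flag is an enumeration \<open>q 1, \<dots>, q n\<close> of the boxes in which the left neighbour of \<open>q a\<close>
  is among \<open>q 1, \<dots>, q (h a)\<close>.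

  Let two such enumerations first differ at \<open>i\<close>, where one picks a box \<open>p'\<close> and the other a box \<open>p\<close>
  whose row continues to the right of \<open>p\<close> at least as long as that of \<open>p'\<close>. Compare the tails of the
  two rows starting at \<open>p'\<close> and \<open>p\<close> box by box, and in the first enumeration exchange each pair for
  which the box of the tail of \<open>p'\<close> comes earlier. Because \<open>h\<close> is monotone, the result is again
  admissible, and rotating all exchanged pairs of basis vectors simultaneously gives a path between the
  two flags inside the variety. The new enumeration agrees with the second one up to \<open>i\<close>; iterating
  connects all coordinate flags.\<close>

subsection \<open>Frames and paths of flags\<close>

text \<open>The hypothesis \<open>ind\<close> concerns the indexed family, so it also excludes
  repeated columns: equal columns at \<open>a\<close> and \<open>b\<close> satisfy a relation with
  coefficients 1 and -1.\<close>

lemma framesI: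
  assumes mem: "\<And>a. a \<in> {1..n} \<Longrightarrow> f a \<in> cspace n"
    and off: "\<And>a. a \<notin> {1..n} \<Longrightarrow> f a = 0"
    and ind: "\<And>c a. (\<And>k. (\<Sum>a\<in>{1..n}. c a * f a k) = 0) \<Longrightarrow> a \<in> {1..n} \<Longrightarrow> c a = 0"
  shows "f \<in> frames n"
proof -
  have inj: "inj_on f {1..n}"
  proof (rule inj_onI, rule ccontr)
    fix a b assume ab: "a \<in> {1..n}" "b \<in> {1..n}" "f a = f b" "a \<noteq> b"
    define c where "c i = (if i = a then 1 else if i = b then - 1 else (0::complex))" for i
    have "(\<Sum>i\<in>{1..n}. c i * f i k) = 0" for k
    proof -
      have "(\<Sum>i\<in>{1..n}. c i * f i k) = (\<Sum>i\<in>{a, b}. c i * f i k)"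
        using ab by (intro sum.mono_neutral_right) (auto simp: c_def)
      then show ?thesis using ab by (simp add: c_def)
    qed
    from ind[OF this ab(1)] show False by (simp add: c_def)
  qed
  have "cvec.independent (f ` {1..n})"
  proof
    assume "cvec.dependent (f ` {1..n})"
    then obtain u a where u: "a \<in> {1..n}" "u (f a) \<noteq> 0" "(\<Sum>v\<in>f ` {1..n}. cscale (u v) v) = 0"
      by (auto simp: cvec.dependent_finite)
    have "(\<Sum>i\<in>{1..n}. u (f i) * f i k) = 0" for k
    proof -
      have "(\<Sum>i\<in>{1..n}. u (f i) * f i k) = (\<Sum>v\<in>f ` {1..n}. u v * v k)"
        using sum.reindex[OF inj, of "\<lambda>v. u v * v k"] by (simp add: o_def)
      also have "\<dots> = (\<Sum>v\<in>f ` {1..n}. cscale (u v) v) k"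
        by (rule sum_fun_apply[symmetric])
      finally show ?thesis unfolding u(3) by simp
    qed
    from ind[OF this u(1)] u(2) show False by simp
  qed
  with inj mem off show ?thesis by (auto simp: frames_def)
qed

lemma span_image_obtain_coeffs:
  assumes "finite A" "y \<in> cvec.span (f ` A)"
  obtains c where "\<And>k. y k = (\<Sum>a\<in>A. c a * f a k)"
proof -
  let ?S = "{y. \<exists>c. \<forall>k. y k = (\<Sum>a\<in>A. c a * f a k)}"
  have "cvec.span (f ` A) \<subseteq> ?S"
  proof (rule cvec.span_minimal)
    show "f ` A \<subseteq> ?S"
    proof clarify
      fix a assume "a \<in> A"
      then show "\<exists>c. \<forall>k. f a k = (\<Sum>i\<in>A. c i * f i k)"
        using assms(1) by (intro exI[of _ "\<lambda>i. if i = a then 1 else 0"]) (simp add: if_distrib[of "\<lambda>x. x * _"] cong: if_cong)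
    qed
    show "cvec.subspace ?S"
      unfolding cvec.subspace_def
    proof (intro conjI allI ballI)
      show "0 \<in> ?S" by (auto intro!: exI[of _ "\<lambda>_. 0"])
    next
      fix x y assume "x \<in> ?S" "y \<in> ?S"
      then obtain c d where "\<forall>k. x k = (\<Sum>a\<in>A. c a * f a k)" "\<forall>k. y k = (\<Sum>a\<in>A. d a * f a k)" by auto
      then show "x + y \<in> ?S"
        by (auto intro!: exI[of _ "\<lambda>a. c a + d a"] simp: sum.distrib algebra_simps)
    next
      fix z x assume "x \<in> ?S"
      then obtain c where "\<forall>k. x k = (\<Sum>a\<in>A. c a * f a k)" by auto
      then show "cscale z x \<in> ?S"
        by (auto intro!: exI[of _ "\<lambda>a. z * c a"] simp: sum_distrib_left algebra_simps)
    qed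
  qed
  with assms that show ?thesis by blast
qed

lemma lincomb_in_span: "(\<lambda>k. \<Sum>a\<in>A. c a * f a k) \<in> cvec.span (f ` A)"
proof -
  have "(\<lambda>k. \<Sum>a\<in>A. c a * f a k) = (\<Sum>a\<in>A. cscale (c a) (f a))"
    by (rule ext) (rule sum_fun_apply[symmetric])
  then show ?thesis by (simp add: cvec.span_sum cvec.span_scale cvec.span_base)
qed

lemma continuous_map_flag_of:
  "continuous_map (top_of_set (frames n)) (flag_topology n) (flag_of n)"
  using flag_of_in_flags
  by (auto simp: continuous_map_def topspace_flag_topology openin_flag_topology)

lemma mat_vec_add: "mat_vec n X (u + v) = mat_vec n X u + mat_vec n X v"
  by (rule ext) (simp add: mat_vec_def sum.distrib[symmetric] algebra_simps)

lemma mat_vec_scale: "mat_vec n X (cscale c v) = cscale c (mat_vec n X v)"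
  by (rule ext) (simp add: mat_vec_def sum_distrib_left algebra_simps)

lemma mat_vec_zero: "mat_vec n X 0 = 0"
  by (rule ext) (simp add: mat_vec_def)

lemma subspace_mat_vec_vimage:
  assumes "cvec.subspace S"
  shows "cvec.subspace {v. mat_vec n X v \<in> S}"
  unfolding cvec.subspace_def
proof (intro conjI ballI allI; unfold mem_Collect_eq)
  show "mat_vec n X 0 \<in> S"
    unfolding mat_vec_zero by (rule cvec.subspace_0[OF assms])
  fix u v assume u: "mat_vec n X u \<in> S" and v: "mat_vec n X v \<in> S"
  show "mat_vec n X (u + v) \<in> S"
    unfolding mat_vec_add by (rule cvec.subspace_add[OF assms u v])
next
  fix c u assume u: "mat_vec n X u \<in> S"
  show "mat_vec n X (cscale c u) \<in> S"
    unfolding mat_vec_scale by (rule cvec.subspace_scale[OF assms u])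
qed

text \<open>By linearity of X and monotonicity of \<open>h\<close>, it is enough to test each column
  \<open>f a\<close> against the span of the first \<open>h a\<close> columns.\<close>

lemma flag_of_in_Hess:
  assumes f: "f \<in> frames n" and h: "mono_on {1..n} h" "\<And>i. i \<in> {1..n} \<Longrightarrow> h i \<le> n"
    and X: "\<And>a. a \<in> {1..n} \<Longrightarrow> mat_vec n X (f a) \<in> cvec.span (f ` {1..h a})"
  shows "flag_of n f \<in> Hess n X h"
proof -
  have "mat_vec n X ` cvec.span (f ` {1..i}) \<subseteq> cvec.span (f ` {1..h i})" if "i \<in> {1..n}" for i
  proof -
    have "f ` {1..i} \<subseteq> {v. mat_vec n X v \<in> cvec.span (f ` {1..h i})}"
    proof clarify
      fix a assume a: "a \<in> {1..i}"
      then have "h a \<le> h i" using mono_onD[OF h(1), of a i] that by auto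
      then have "cvec.span (f ` {1..h a}) \<subseteq> cvec.span (f ` {1..h i})"
        by (intro cvec.span_mono image_mono) auto
      moreover have "mat_vec n X (f a) \<in> cvec.span (f ` {1..h a})"
        using X[of a] a that by auto
      ultimately show "mat_vec n X (f a) \<in> cvec.span (f ` {1..h i})" by blast
    qed
    then have "cvec.span (f ` {1..i}) \<subseteq> {v. mat_vec n X v \<in> cvec.span (f ` {1..h i})}"
      by (intro cvec.span_minimal subspace_mat_vec_vimage cvec.subspace_span)
    then show ?thesis by blast
  qed
  moreover have "flag_of n f i = cvec.span (f ` {1..i})" if "i \<le> n" for i
    using that by (simp add: flag_of_def)
  ultimately show ?thesis
    using flag_of_in_flags[OF f] h(2) by (simp add: Hess_def)
qed

text \<open>Frames carry the entrywise topology and \<open>flag_of n\<close> is continuous, so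
  connecting flags reduces to entrywise continuous paths of frames.\<close>

lemma flag_of_path_connected_component:
  fixes g :: "real \<Rightarrow> nat \<Rightarrow> nat \<Rightarrow> complex"
  assumes cont: "\<And>a k. continuous_on {0..1} (\<lambda>t. g t a k)"
    and g: "\<And>t. t \<in> {0..1} \<Longrightarrow> g t \<in> frames n"
    and S: "\<And>t. t \<in> {0..1} \<Longrightarrow> flag_of n (g t) \<in> S"
  shows "connected_component_of (subtopology (flag_topology n) S) (flag_of n (g 0)) (flag_of n (g 1))"
proof -
  have "continuous_on {0..1} g"
    by (intro continuous_on_coordinatewise_then_product cont)
  then have "continuous_map (top_of_set {0..1}) (top_of_set (frames n)) g"
    using g by (auto simp: continuous_map_in_subtopology)
  then have "continuous_map (top_of_set {0..1}) (flag_topology n) (flag_of n \<circ> g)"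
    using continuous_map_flag_of continuous_map_compose by blast
  then have "continuous_map (top_of_set {0..1}) (subtopology (flag_topology n) S) (flag_of n \<circ> g)"
    using S by (auto simp: continuous_map_in_subtopology)
  moreover have "connectedin (top_of_set {0..1::real}) {0..1}"
    by (simp add: connectedin_subtopology)
  ultimately have "connectedin (subtopology (flag_topology n) S) ((flag_of n \<circ> g) ` {0..1})"
    by (rule connectedin_continuous_map_image)
  then show ?thesis
    unfolding connected_component_of_def by (intro exI[of _ "(flag_of n \<circ> g) ` {0..1}"]) auto
qed

text \<open>The paths constructed below end at coordinate frames only up to nonzero scalars on the
  columns; the flag does not see them.\<close>

lemma flag_of_rescale:
  assumes "\<And>a. a \<in> {1..n} \<Longrightarrow> c a \<noteq> 0 \<and> f a = cscale (c a) (g a)"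
  shows "flag_of n f = flag_of n g"
proof -
  have "cvec.span (f ` {1..i}) = cvec.span (g ` {1..i})" if "i \<le> n" for i
    unfolding cvec.span_eq
  proof (intro conjI subsetI; clarify)
    fix a assume a: "a \<in> {1..i}"
    then have c: "c a \<noteq> 0" "f a = cscale (c a) (g a)" using assms that by auto
    then have "g a = cscale (1 / c a) (f a)" by auto
    then show "g a \<in> cvec.span (f ` {1..i})"
      using cvec.span_scale[OF cvec.span_base[of "f a" "f ` {1..i}"], of "1 / c a"] a by simp
    from c a show "f a \<in> cvec.span (g ` {1..i})"
      using cvec.span_scale[OF cvec.span_base[of "g a" "g ` {1..i}"], of "c a"] by simp
  qed
  then show ?thesis
    unfolding flag_of_def by (intro restrict_ext) auto
qed

subsection \<open>Leading boxes\<close>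

text \<open>This is the action of X on unit vectors; \<open>None\<close> stands for the zero vector,
  the image of a unit vector of the first column.\<close>

definition left_box :: "nat \<times> nat \<Rightarrow> (nat \<times> nat) option" where
  "left_box b = (case snd b of 0 \<Rightarrow> None | Suc c \<Rightarrow> Some (fst b, c))"

lemma left_box_eq_Some: "left_box b = Some b0 \<longleftrightarrow> b = (fst b0, Suc (snd b0))"
  by (cases b; cases b0) (auto simp: left_box_def split: nat.split)

lemma left_box_simps [simp]: "left_box (r, 0) = None" "left_box (r, Suc c) = Some (r, c)"
  by (simp_all add: left_box_def)

lemma left_box_in_boxes: "b \<in> boxes lam \<Longrightarrow> left_box b = Some b0 \<Longrightarrow> b0 \<in> boxes lam"
  by (auto simp: boxes_def left_box_eq_Some)

lemma X_mat_entry: "X_mat lam i j = (if (i, j) \<in> adjacent_labels lam then 1 else 0)"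
proof -
  have "adjacent_labels lam \<subseteq> (\<lambda>(r, c). (base_label lam (r, c), base_label lam (r, Suc c))) ` boxes lam"
    by (auto simp: adjacent_labels_def)
  then have fin: "finite (adjacent_labels lam)"
    by (rule finite_subset) (simp add: finite_boxes)
  have "X_mat lam i j = (\<Sum>p\<in>adjacent_labels lam. if p = (i, j) then 1 else 0)"
    unfolding X_mat_def by (intro sum.cong) (auto simp: elem_mat_def split: if_splits)
  then show ?thesis using fin by simp
qed

definition unit_vec :: "nat list \<Rightarrow> nat \<times> nat \<Rightarrow> nat \<Rightarrow> complex" where
  "unit_vec lam b = (\<lambda>k. if k = base_label lam b then 1 else 0)"

section \<open>The nilpotent map in box coordinates\<close>

locale diagram =
  fixes n :: nat and lam :: "nat list"
  assumes composition: "weak_composition lam n"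
begin

abbreviation lab where "lab \<equiv> base_label lam"

lemma lab_bij: "bij_betw lab (boxes lam) {1..n}"
  using bij_betw_base_label composition .

lemma lab_range: "b \<in> boxes lam \<Longrightarrow> lab b \<in> {1..n}"
  using lab_bij by (auto simp: bij_betw_def)

lemma lab_eq_iff: "b \<in> boxes lam \<Longrightarrow> b' \<in> boxes lam \<Longrightarrow> lab b = lab b' \<longleftrightarrow> b = b'"
  using lab_bij by (auto simp: bij_betw_def inj_on_def)

lemma card_boxes: "card (boxes lam) = n"
  using bij_betw_same_card[OF lab_bij] by simp

lemma mat_vec_lab:
  assumes "(r, c) \<in> boxes lam"
  shows "mat_vec n (X_mat lam) v (lab (r, c)) =
    (if (r, Suc c) \<in> boxes lam then v (lab (r, Suc c)) else 0)"
proof -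
  have adj: "(lab (r, c), j) \<in> adjacent_labels lam \<longleftrightarrow> (r, Suc c) \<in> boxes lam \<and> j = lab (r, Suc c)" for j
    using assms lab_eq_iff by (fastforce simp: adjacent_labels_def)
  have "mat_vec n (X_mat lam) v (lab (r, c)) = (\<Sum>j\<in>{1..n}. X_mat lam (lab (r, c)) j * v j)"
    using lab_range[OF assms] by (simp add: mat_vec_def)
  also have "\<dots> = (\<Sum>j\<in>{1..n}. if j = lab (r, Suc c) then
      (if (r, Suc c) \<in> boxes lam then v (lab (r, Suc c)) else 0) else 0)"
    by (intro sum.cong) (auto simp: X_mat_entry adj)
  also have "\<dots> = (if (r, Suc c) \<in> boxes lam then v (lab (r, Suc c)) else 0)"
    using lab_range[of "(r, Suc c)"] by auto
  finally show ?thesis .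
qed

lemma cspace_eqI:
  assumes "u \<in> cspace n" "v \<in> cspace n" "\<And>b. b \<in> boxes lam \<Longrightarrow> u (lab b) = v (lab b)"
  shows "u = v"
proof
  fix k
  show "u k = v k"
  proof (cases "k \<in> {1..n}")
    case True
    then obtain b where "b \<in> boxes lam" "k = lab b" using lab_bij by (metis bij_betw_imp_surj_on imageE)
    then show ?thesis using assms by simp
  qed (use assms in \<open>auto simp: cspace_def\<close>)
qed

lemma unit_vec_cspace: "b \<in> boxes lam \<Longrightarrow> unit_vec lam b \<in> cspace n"
  using lab_range by (auto simp: unit_vec_def cspace_def)

lemma unit_vec_lab: "b \<in> boxes lam \<Longrightarrow> b' \<in> boxes lam \<Longrightarrow> unit_vec lam b (lab b') = (if b' = b then 1 else 0)"
  by (auto simp: unit_vec_def lab_eq_iff)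

lemma mat_vec_cspace: "mat_vec n X v \<in> cspace n"
  by (simp add: mat_vec_def cspace_def)

lemma mat_vec_unit_vec:
  assumes b: "b \<in> boxes lam"
  shows "mat_vec n (X_mat lam) (unit_vec lam b) = (case left_box b of None \<Rightarrow> 0 | Some b0 \<Rightarrow> unit_vec lam b0)"
    (is "_ = ?R")
proof (rule cspace_eqI)
  show "?R \<in> cspace n"
    using unit_vec_cspace left_box_in_boxes[OF b]
    by (auto split: option.split simp: cspace_def)
  fix b' assume b': "b' \<in> boxes lam"
  obtain r c where rc: "b' = (r, c)" by fastforce
  show "mat_vec n (X_mat lam) (unit_vec lam b) (lab b') = ?R (lab b')"
  proof (cases "left_box b")
    case None
    then have "b \<noteq> (r, Suc c)" by auto
    with None b b' show ?thesis by (auto simp: rc mat_vec_lab unit_vec_lab)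
  next
    case (Some b0)
    have "b0 \<in> boxes lam" using left_box_in_boxes[OF b Some] .
    moreover have "b = (r, Suc c) \<longleftrightarrow> b' = b0"
      using Some by (auto simp: rc left_box_eq_Some)
    ultimately show ?thesis using b b' Some by (auto simp: rc mat_vec_lab unit_vec_lab)
  qed
qed (rule mat_vec_cspace)

section \<open>Torus weights and leads of vectors\<close>

definition weight :: "nat \<times> nat \<Rightarrow> nat" where
  "weight b = fst b * Suc n + snd b"

lemma weight_inj: "b \<in> boxes lam \<Longrightarrow> b' \<in> boxes lam \<Longrightarrow> weight b = weight b' \<Longrightarrow> b = b'"
proof -
  \<comment> \<open>A row has at most \<open>n\<close> boxes, so row and column are the quotient and
    the remainder of the weight modulo \<open>n + 1\<close>.\<close>
  have "snd b < Suc n \<and> weight b div Suc n = fst b \<and> weight b mod Suc n = snd b" if "b \<in> boxes lam" for b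
  proof -
    have "snd b < lam ! fst b" "fst b < length lam" using that by (auto simp: boxes_def)
    moreover have "lam ! fst b \<le> n"
      using composition elem_le_sum_list[of "fst b" lam] calculation by (simp add: weak_composition_def)
    ultimately have "snd b < Suc n" by simp
    then show ?thesis by (simp add: weight_def del: mult_Suc_right)
  qed
  then show "b \<in> boxes lam \<Longrightarrow> b' \<in> boxes lam \<Longrightarrow> weight b = weight b' \<Longrightarrow> b = b'"
    by (metis prod_eqI)
qed

lemma weight_Suc: "weight (r, Suc c) = Suc (weight (r, c))"
  by (simp add: weight_def)

text \<open>The lead is the term of lowest weight, the one that survives when the torus parameter
  tends to 0 after normalization.\<close>

definition is_lead :: "(nat \<Rightarrow> complex) \<Rightarrow> nat \<times> nat \<Rightarrow> bool" where
  "is_lead v b \<longleftrightarrow> b \<in> boxes lam \<and> v (lab b) \<noteq> 0 \<and> (\<forall>b'\<in>boxes lam. weight b' < weight b \<longrightarrow> v (lab b') = 0)"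

lemma is_lead_exists:
  assumes "v \<in> cspace n" "v \<noteq> 0"
  obtains b where "is_lead v b"
proof -
  have "\<exists>b. b \<in> boxes lam \<and> v (lab b) \<noteq> 0"
    using assms cspace_eqI[of v 0] by (auto simp: cspace_def)
  then obtain b where b: "b \<in> boxes lam \<and> v (lab b) \<noteq> 0"
    "\<And>b'. b' \<in> boxes lam \<and> v (lab b') \<noteq> 0 \<Longrightarrow> weight b \<le> weight b'"
    using ex_has_least_nat[of "\<lambda>b. b \<in> boxes lam \<and> v (lab b) \<noteq> 0" _ weight] by blast
  then have "is_lead v b" unfolding is_lead_def using leD by blast
  then show ?thesis by (rule that)
qed

lemma is_lead_unique: "is_lead v b \<Longrightarrow> is_lead v b' \<Longrightarrow> b = b'"
  unfolding is_lead_def using weight_inj by (metis linorder_neqE_nat)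

text \<open>Evaluate the sum at the lead of smallest weight among the terms with nonzero coefficient.\<close>

lemma is_lead_sum:
  assumes fin: "finite A" and inj: "inj_on q A" and lead: "\<And>a. a \<in> A \<Longrightarrow> is_lead (f a) (q a)"
    and nz: "a \<in> A" "c a \<noteq> 0"
  shows "\<exists>a0\<in>A. is_lead (\<lambda>k. \<Sum>a\<in>A. c a * f a k) (q a0)"
proof -
  obtain a0 where a0: "a0 \<in> A \<and> c a0 \<noteq> 0" "\<And>a. a \<in> A \<and> c a \<noteq> 0 \<Longrightarrow> weight (q a0) \<le> weight (q a)"
    using ex_has_least_nat[of "\<lambda>a. a \<in> A \<and> c a \<noteq> 0" _ "\<lambda>a. weight (q a)"] nz by blast
  have box: "q a \<in> boxes lam" if "a \<in> A" for a using lead[OF that] by (simp add: is_lead_def)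
  have low: "c a * f a (lab b) = 0" if "a \<in> A" "b \<in> boxes lam" "weight b < weight (q a0)" for a b
  proof (cases "c a = 0")
    case False
    then have "weight b < weight (q a)" using a0(2)[of a] that by simp
    then show ?thesis using lead[OF that(1)] that(2) by (simp add: is_lead_def)
  qed simp
  have other: "c a * f a (lab (q a0)) = 0" if "a \<in> A" "a \<noteq> a0" for a
  proof (cases "c a = 0")
    case False
    then have "weight (q a0) \<le> weight (q a)" using a0(2)[of a] that by simp
    moreover have "weight (q a0) \<noteq> weight (q a)"
      using weight_inj box a0(1) that inj by (metis inj_on_def)
    ultimately have "weight (q a0) < weight (q a)" by simp
    then show ?thesis using lead[OF that(1)] box a0(1) by (simp add: is_lead_def)
  qed simp
  have "(\<Sum>a\<in>A. c a * f a (lab (q a0))) = c a0 * f a0 (lab (q a0))"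
  proof -
    have "(\<Sum>a\<in>A - {a0}. c a * f a (lab (q a0))) = 0"
      by (rule sum.neutral) (use other in blast)
    then show ?thesis using a0(1) fin by (subst sum.remove[of _ a0]) auto
  qed
  then have "(\<Sum>a\<in>A. c a * f a (lab (q a0))) \<noteq> 0"
    using a0(1) lead[of a0] by (simp add: is_lead_def)
  then have "is_lead (\<lambda>k. \<Sum>a\<in>A. c a * f a k) (q a0)"
    using low box a0(1) by (auto simp: is_lead_def intro!: sum.neutral)
  then show ?thesis using a0(1) by blast
qed

text \<open>Distinct leads force independence: a combination with a nonzero coefficient has a lead,
  hence is not zero.\<close>

lemma frames_of_leads:
  assumes "\<And>a. a \<in> {1..n} \<Longrightarrow> f a \<in> cspace n" "\<And>a. a \<notin> {1..n} \<Longrightarrow> f a = 0"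
    and inj: "inj_on q {1..n}" and lead: "\<And>a. a \<in> {1..n} \<Longrightarrow> is_lead (f a) (q a)"
  shows "f \<in> frames n"
proof (rule framesI[OF assms(1,2)])
  fix c :: "nat \<Rightarrow> complex" and a
  assume z: "\<And>k. (\<Sum>a\<in>{1..n}. c a * f a k) = 0" and a: "a \<in> {1..n}"
  show "c a = 0"
  proof (rule ccontr)
    assume "c a \<noteq> 0"
    from is_lead_sum[where f = f and c = c, OF _ inj lead a this] show False
      unfolding z by (auto simp: is_lead_def)
  qed
qed

text \<open>Nothing cancels between distinct leads, so a nonzero combination inherits the lead of
  one of its terms.\<close>

lemma lead_of_span:
  assumes "inj_on q A" "finite A" and lead: "\<And>a. a \<in> A \<Longrightarrow> is_lead (f a) (q a)"
    and y: "y \<in> cvec.span (f ` A)" "is_lead y b"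
  shows "b \<in> q ` A"
proof -
  obtain c where c: "\<And>k. y k = (\<Sum>a\<in>A. c a * f a k)"
    using span_image_obtain_coeffs[OF assms(2) y(1)] by blast
  then have yc: "y = (\<lambda>k. \<Sum>a\<in>A. c a * f a k)" by auto
  have "\<exists>a\<in>A. c a \<noteq> 0"
  proof (rule ccontr)
    assume "\<not> ?thesis"
    then have "y k = 0" for k by (simp add: c)
    with y(2) show False by (simp add: is_lead_def)
  qed
  then obtain a where "a \<in> A" "c a \<noteq> 0" by blast
  from is_lead_sum[where f = f and q = q and c = c, OF assms(2,1) lead this] obtain a0
    where "a0 \<in> A" "is_lead y (q a0)" unfolding yc by blast
  with is_lead_unique[OF y(2)] show ?thesis by blast
qed

text \<open>X lowers every weight by one and so preserves the order of the terms; a lead outside the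
  first column is not killed.\<close>

lemma lead_mat_vec:
  assumes "is_lead v (r, Suc c)"
  shows "is_lead (mat_vec n (X_mat lam) v) (r, c)"
proof -
  have rc: "(r, Suc c) \<in> boxes lam" "(r, c) \<in> boxes lam" using assms by (auto simp: is_lead_def boxes_def)
  have "mat_vec n (X_mat lam) v (lab b) = 0" if b: "b \<in> boxes lam" "weight b < weight (r, c)" for b
  proof -
    obtain r' c' where b': "b = (r', c')" by fastforce
    have "weight (r', Suc c') < weight (r, Suc c)" using b by (simp add: weight_Suc b')
    then show ?thesis using b assms unfolding b' by (auto simp: mat_vec_lab is_lead_def)
  qed
  then show ?thesis using assms rc by (simp add: is_lead_def mat_vec_lab)
qed

section \<open>Frames adapted to a flag\<close>

lemma flag_mono:
  assumes V: "V \<in> flags n" and "i \<le> j" "j \<le> n"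
  shows "V i \<subseteq> V j"
  using assms(2,3)
proof (induction j rule: dec_induct)
  case (step j)
  have "V j \<subseteq> V (Suc j)"
  proof (cases "j = 0")
    case True
    have "cvec.subspace (V (Suc 0))" using V step by (auto simp: flags_def)
    then show ?thesis using V True cvec.subspace_0 by (auto simp: flags_def)
  qed (use V step in \<open>auto simp: flags_def\<close>)
  then show ?case using step by auto
qed simp

text \<open>Choose \<open>f a\<close> in \<open>V a - V (a - 1)\<close> with lead of maximal weight: if \<open>f a\<close> and \<open>f b\<close> with \<open>a < b\<close> had
  the same lead, a combination of them in \<open>V b - V (b - 1)\<close> would have a lead of larger weight.\<close>

lemma flag_adapted_frame:
  assumes V: "V \<in> flags n"
  obtains f q where "f \<in> frames n" "flag_of n f = V" "inj_on q {1..n}"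
    "\<And>a. a \<in> {1..n} \<Longrightarrow> is_lead (f a) (q a)"
proof -
  have sub: "cvec.subspace (V a)" and dim: "cvec.dim (V a) = a" if "a \<le> n" for a
  proof -
    have "cvec.subspace {0}" "cvec.dim {0} = 0"
      using cvec.subspace_span[of "{}"] cvec.dim_span[of "{}"]
        cvec.dim_eq_card_independent[OF cvec.independent_empty] by simp_all
    then show "cvec.subspace (V a)" "cvec.dim (V a) = a"
      using V that by (cases "a = 0"; simp add: flags_def)+
  qed
  have csp: "V a \<subseteq> cspace n" if "a \<le> n" for a
    using flag_mono[OF V that] V by (auto simp: flags_def)
  have "\<exists>v b. v \<in> V a - V (a - 1) \<and> is_lead v b \<and>
      (\<forall>v' b'. v' \<in> V a - V (a - 1) \<longrightarrow> is_lead v' b' \<longrightarrow> weight b' \<le> weight b)" if a: "a \<in> {1..n}" for a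
  proof -
    let ?P = "\<lambda>m. \<exists>v b. v \<in> V a - V (a - 1) \<and> is_lead v b \<and> m = weight b"
    have "V (a - 1) \<noteq> V a" using dim[of a] dim[of "a - 1"] a by force
    then obtain v where v: "v \<in> V a - V (a - 1)" using flag_mono[OF V, of "a - 1" a] a by auto
    have "0 \<in> V (a - 1)" using a by (intro cvec.subspace_0 sub) auto
    then have "v \<noteq> 0" using v by auto
    moreover have "v \<in> cspace n" using v csp a by auto
    ultimately obtain b where "is_lead v b" using is_lead_exists by blast
    then have ex: "\<exists>m. ?P m" using v by blast
    have "{m. ?P m} \<subseteq> weight ` boxes lam" by (auto simp: is_lead_def)
    then have fin: "finite {m. ?P m}" by (rule finite_subset) (simp add: finite_boxes)
    have "?P (Max {m. ?P m})" using Max_in[OF fin] ex by blast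
    then obtain v b where vb: "v \<in> V a - V (a - 1)" "is_lead v b" "Max {m. ?P m} = weight b" by blast
    have "weight b' \<le> weight b" if "v' \<in> V a - V (a - 1)" "is_lead v' b'" for v' b'
    proof -
      have "weight b' \<in> {m. ?P m}" using that by blast
      from Max_ge[OF fin this] show ?thesis unfolding vb(3) .
    qed
    with vb show ?thesis by blast
  qed
  then obtain f0 q where f0: "\<And>a. a \<in> {1..n} \<Longrightarrow> f0 a \<in> V a - V (a - 1)"
    and lead0: "\<And>a. a \<in> {1..n} \<Longrightarrow> is_lead (f0 a) (q a)"
    and max: "\<And>a v' b'. a \<in> {1..n} \<Longrightarrow> v' \<in> V a - V (a - 1) \<Longrightarrow> is_lead v' b' \<Longrightarrow> weight b' \<le> weight (q a)"
    by metis
  define f where "f = (\<lambda>a. if a \<in> {1..n} then f0 a else 0)"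
  have f: "f a \<in> V a - V (a - 1)" and lead: "is_lead (f a) (q a)" if "a \<in> {1..n}" for a
    using f0 lead0 that by (auto simp: f_def)
  have neq: "q a \<noteq> q b" if ab: "a \<in> {1..n}" "b \<in> {1..n}" "a < b" for a b
  proof
    assume eq: "q a = q b"
    \<comment> \<open>The factor \<open>s\<close> cancels the coefficient at the common lead. As
      \<open>f a\<close> lies in \<open>V (b - 1)\<close>, subtracting its multiple keeps
      \<open>u\<close> outside \<open>V (b - 1)\<close>.\<close>
    define s where "s = f b (lab (q b)) / f a (lab (q b))"
    define u where "u = f b - cscale s (f a)"
    have fa: "f a \<in> V (b - 1)" using f[OF ab(1)] flag_mono[OF V, of a "b - 1"] ab by force
    have sa: "cscale s (f a) \<in> V (b - 1)" using cvec.subspace_scale[OF sub fa] ab by auto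
    then have sb: "cscale s (f a) \<in> V b" using flag_mono[OF V, of "b - 1" b] ab by auto
    have u: "u \<in> V b - V (b - 1)"
    proof
      show "u \<in> V b" unfolding u_def using cvec.subspace_diff[OF sub _ sb] f[OF ab(2)] ab by auto
      show "u \<notin> V (b - 1)"
      proof
        assume "u \<in> V (b - 1)"
        then have "u + cscale s (f a) \<in> V (b - 1)" using cvec.subspace_add[OF sub _ sa] ab by auto
        then show False using f[OF ab(2)] by (simp add: u_def)
      qed
    qed
    moreover have "0 \<in> V (b - 1)" using ab by (intro cvec.subspace_0 sub) auto
    ultimately have "u \<noteq> 0" by auto
    moreover have "u \<in> cspace n" using u csp ab by auto
    ultimately obtain d where d: "is_lead u d" using is_lead_exists by blast
    then have "weight d \<le> weight (q b)" using max[OF ab(2) u] by blast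
    \<comment> \<open>At the common lead \<open>u\<close> vanishes by the choice of
      \<open>s\<close>, and below it both \<open>f a\<close> and \<open>f b\<close> vanish. So the
      lead of \<open>u\<close> would outweigh \<open>q b\<close>, against maximality.\<close>
    moreover have "u (lab d) = 0" if "weight d \<le> weight (q b)"
    proof (cases "d = q b")
      case True
      have "f a (lab (q b)) \<noteq> 0" using lead[OF ab(1)] by (simp add: is_lead_def eq)
      then show ?thesis by (simp add: u_def s_def True)
    next
      case False
      then have "weight d < weight (q b)"
        using that weight_inj[of d "q b"] d lead[OF ab(2)] by (force simp: is_lead_def)
      then show ?thesis using d lead[OF ab(2)] lead[OF ab(1)] by (simp add: is_lead_def u_def eq)
    qed
    ultimately show False using d by (simp add: is_lead_def)
  qed
  have inj: "inj_on q {1..n}"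
    by (rule linorder_inj_onI) (use neq in auto)
  have fr: "f \<in> frames n"
  proof (rule frames_of_leads[OF _ _ inj lead])
    show "f a \<in> cspace n" if "a \<in> {1..n}" for a using f[OF that] csp[of a] that by auto
  qed (auto simp: f_def)
  have "flag_of n f = V"
  proof
    fix i
    show "flag_of n f i = V i"
    proof (cases "i \<in> {0..n}")
      case True
      then have i: "i \<le> n" by simp
      have le: "cvec.span (f ` {1..i}) \<subseteq> V i"
      proof (intro cvec.span_minimal sub i; clarify)
        fix a assume "a \<in> {1..i}"
        then show "f a \<in> V i" using f[of a] flag_mono[OF V, of a i] i by auto
      qed
      have fl: "flag_of n f i = cvec.span (f ` {1..i})" using True by (simp add: flag_of_def)
      have fin: "cvec.independent (f ` {1..i})" "card (f ` {1..i}) = i"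
      proof -
        have "{1..i} \<subseteq> {1..n}" using i by auto
        moreover have "inj_on f {1..n}" "cvec.independent (f ` {1..n})"
          using fr by (auto simp: frames_def)
        ultimately have "inj_on f {1..i}" "cvec.independent (f ` {1..i})"
          using inj_on_subset cvec.independent_mono[OF _ image_mono] by blast+
        then show "cvec.independent (f ` {1..i})" "card (f ` {1..i}) = i"
          by (simp_all add: card_image)
      qed
      \<comment> \<open>A vector of \<open>V i\<close> outside the span would give
        \<open>i + 1\<close> independent vectors in dimension \<open>i\<close>.\<close>
      have "V i \<subseteq> cvec.span (f ` {1..i})"
      proof
        fix v assume v: "v \<in> V i"
        show "v \<in> cvec.span (f ` {1..i})"
        proof (rule ccontr)
          assume nv: "v \<notin> cvec.span (f ` {1..i})"
          then have ind: "cvec.independent (insert v (f ` {1..i}))"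
            using cvec.independent_insertI[OF _ fin(1)] by simp
          obtain B where B: "B \<subseteq> V i" "cvec.independent B" "V i \<subseteq> cvec.span B" "card B = cvec.dim (V i)"
            using cvec.basis_exists by blast
          \<comment> \<open>Infinite sets have \<open>card\<close> 0, so a positive dimension makes
            the basis finite; in dimension 0 it lies in the zero space.\<close>
          have "finite B"
          proof (cases "i = 0")
            case True
            then have "B \<subseteq> {0}" using B(1) V by (auto simp: flags_def)
            then show ?thesis by (rule finite_subset) simp
          next
            case False
            then have "0 < card B" unfolding B(4) dim[OF i] by (rule neq0_conv[THEN iffD1])
            then show ?thesis by (rule card_ge_0_finite)
          qed
          moreover have "insert v (f ` {1..i}) \<subseteq> cvec.span B"
          proof -
            have "f ` {1..i} \<subseteq> cvec.span (f ` {1..i})" by (rule cvec.span_superset)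
            with v le B(3) show ?thesis by blast
          qed
          ultimately have "card (insert v (f ` {1..i})) \<le> card B"
            using ind by (simp add: cvec.independent_span_bound)
          moreover have "v \<notin> f ` {1..i}" using nv cvec.span_base by blast
          then have "card (insert v (f ` {1..i})) = Suc i" using fin(2) by simp
          ultimately show False unfolding B(4) dim[OF i] by linarith
        qed
      qed
      with le show ?thesis unfolding fl by (rule subset_antisym)
    next
      case False
      then show ?thesis using V by (auto simp: flags_def flag_of_def extensional_def)
    qed
  qed
  from fr this inj lead show ?thesis by (rule that)
qed

end

subsection \<open>Contraction to coordinate flags\<close>

locale hess_diagram = diagram +
  fixes h :: "nat \<Rightarrow> nat"
  assumes h_mono: "mono_on {1..n} h" and h_less: "\<And>i. i \<in> {1..n} \<Longrightarrow> h i < i"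
begin

lemma h_le: "i \<in> {1..n} \<Longrightarrow> h i \<le> n"
  using h_less by force

lemma h_monoD: "1 \<le> i \<Longrightarrow> i \<le> j \<Longrightarrow> j \<le> n \<Longrightarrow> h i \<le> h j"
  using mono_onD[OF h_mono, of i j] by auto

abbreviation "Hess_topology \<equiv> subtopology (flag_topology n) (Hess n (X_mat lam) h)"

definition admissible :: "(nat \<Rightarrow> nat \<times> nat) \<Rightarrow> bool" where
  "admissible q \<longleftrightarrow> bij_betw q {1..n} (boxes lam) \<and>
     (\<forall>a\<in>{1..n}. \<forall>b. left_box (q a) = Some b \<longrightarrow> b \<in> q ` {1..h a})"

definition coord_frame :: "(nat \<Rightarrow> nat \<times> nat) \<Rightarrow> nat \<Rightarrow> nat \<Rightarrow> complex" where
  "coord_frame q = (\<lambda>a. if a \<in> {1..n} then unit_vec lam (q a) else 0)"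

abbreviation coord_flag where "coord_flag q \<equiv> flag_of n (coord_frame q)"

text \<open>The coordinate flag is the limit of \<open>V\<close> under the torus as the parameter
  tends to 0, and \<open>q\<close> lists the leads of a frame adapted to \<open>V\<close>.\<close>

lemma Hess_contracts_to_coord_flag:
  assumes V: "V \<in> Hess n (X_mat lam) h"
  obtains q where "admissible q" "connected_component_of Hess_topology (coord_flag q) V"
proof -
  have VF: "V \<in> flags n" and VH: "\<And>i v. i \<in> {1..n} \<Longrightarrow> v \<in> V i \<Longrightarrow> mat_vec n (X_mat lam) v \<in> V (h i)"
    using V unfolding Hess_def by blast+
  obtain f q where f: "f \<in> frames n" and fV: "flag_of n f = V" and inj: "inj_on q {1..n}"
    and lead: "\<And>a. a \<in> {1..n} \<Longrightarrow> is_lead (f a) (q a)"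
    using flag_adapted_frame[OF VF] by metis
  have fc: "f a \<in> cspace n" if "a \<in> {1..n}" for a using f that by (simp add: frames_def)
  have f0: "f a = 0" if "a \<notin> {1..n}" for a using f that by (simp add: frames_def)
  have Vi: "V i = cvec.span (f ` {1..i})" if "i \<le> n" for i
    unfolding fV[symmetric] using that by (simp add: flag_of_def)
  have box: "q a \<in> boxes lam" if "a \<in> {1..n}" for a using lead[OF that] by (simp add: is_lead_def)
  have bij: "bij_betw q {1..n} (boxes lam)"
    unfolding bij_betw_def
  proof
    have "card (q ` {1..n}) = card (boxes lam)" unfolding card_image[OF inj] card_boxes by simp
    then show "q ` {1..n} = boxes lam" using box by (intro card_subset_eq finite_boxes) auto
  qed (rule inj)
  have Xf: "mat_vec n (X_mat lam) (f a) \<in> cvec.span (f ` {1..h a})" if a: "a \<in> {1..n}" for a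
  proof -
    have "a \<le> n" "f a \<in> f ` {1..a}" using a by auto
    then have "f a \<in> V a" unfolding Vi[OF \<open>a \<le> n\<close>] by (intro cvec.span_base)
    from VH[OF a this] show ?thesis unfolding Vi[OF h_le[OF a]] .
  qed
  \<comment> \<open>X maps \<open>f a\<close> into the span of the first \<open>h a\<close> columns,
    and the lead of the image is the left neighbour of \<open>q a\<close>; so this box is one of
    their leads.\<close>
  have left: "b \<in> q ` {1..h a}" if a: "a \<in> {1..n}" and b: "left_box (q a) = Some b" for a b
  proof -
    have "q a = (fst b, Suc (snd b))" using b by (simp add: left_box_eq_Some)
    then have l: "is_lead (mat_vec n (X_mat lam) (f a)) b"
      using lead[OF a] lead_mat_vec[of "f a" "fst b" "snd b"] by simp
    have sub: "{1..h a} \<subseteq> {1..n}" using h_le[OF a] by auto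
    show ?thesis
      by (rule lead_of_span[OF inj_on_subset[OF inj sub] _ _ Xf[OF a] l]) (use lead sub in auto)
  qed
  from left have adm: "admissible q" using bij by (auto simp: admissible_def)
  define box_of where "box_of = the_inv_into (boxes lam) lab"
  have box_of: "box_of (lab b) = b" if "b \<in> boxes lam" for b
    using that lab_bij by (simp add: box_of_def the_inv_into_f_f bij_betw_def)
  \<comment> \<open>The torus element \<open>t\<close> applied to \<open>f a\<close>, divided by \<open>t\<close> to the weight of the lead. The subtraction is
    truncated only where the coefficient of \<open>f a\<close> vanishes.\<close>
  define g :: "real \<Rightarrow> nat \<Rightarrow> nat \<Rightarrow> complex" where
    "g t a k = complex_of_real (t ^ (weight (box_of k) - weight (q a))) * f a k" for t a k
  have g_lab: "g t a (lab b) = complex_of_real (t ^ (weight b - weight (q a))) * f a (lab b)"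
    if "b \<in> boxes lam" for t a b by (simp add: g_def box_of that)
  have g_lead: "is_lead (g t a) (q a)" if "a \<in> {1..n}" for t a
    using lead[OF that] by (auto simp: is_lead_def g_lab)
  have g_frame: "g t \<in> frames n" for t
  proof (rule frames_of_leads[OF _ _ inj g_lead])
    show "g t a \<in> cspace n" if "a \<in> {1..n}" for a using fc[OF that] by (auto simp: cspace_def g_def)
    show "g t a = 0" if "a \<notin> {1..n}" for a using f0[OF that] by (intro ext) (simp add: g_def)
  qed
  have g1: "g 1 = f" by (intro ext) (simp add: g_def)
  have nz: "f a (lab (q a)) \<noteq> 0" if "a \<in> {1..n}" for a
    using lead[OF that] by (simp add: is_lead_def)
  \<comment> \<open>Only the lead survives: its factor is \<open>0 ^ 0 = 1\<close>, heavier boxes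
    get a positive power of 0, and lighter ones have coefficient 0.\<close>
  have g_0: "g 0 a = cscale (f a (lab (q a))) (unit_vec lam (q a))" if a: "a \<in> {1..n}" for a
  proof (rule cspace_eqI)
    show "g 0 a \<in> cspace n" using fc[OF a] by (auto simp: cspace_def g_def)
    show "cscale (f a (lab (q a))) (unit_vec lam (q a)) \<in> cspace n"
      using unit_vec_cspace[OF box[OF a]] by (auto simp: cspace_def)
    fix b assume b: "b \<in> boxes lam"
    show "g 0 a (lab b) = f a (lab (q a)) * unit_vec lam (q a) (lab b)"
    proof (cases "b = q a")
      case False
      then have "weight b \<noteq> weight (q a)" using weight_inj b box[OF a] by blast
      then have "g 0 a (lab b) = 0"
        using lead[OF a] b by (cases "weight b < weight (q a)") (auto simp: g_lab is_lead_def power_0_left)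
      then show ?thesis using False b box[OF a] by (simp add: unit_vec_lab)
    qed (use b in \<open>simp add: g_lab unit_vec_lab\<close>)
  qed
  have g0: "flag_of n (g 0) = coord_flag q"
  proof (rule flag_of_rescale, intro conjI)
    fix a assume a: "a \<in> {1..n}"
    show "f a (lab (q a)) \<noteq> 0" by (rule nz[OF a])
    show "g 0 a = cscale (f a (lab (q a))) (coord_frame q a)"
      using g_0[OF a] a by (simp add: coord_frame_def)
  qed
  \<comment> \<open>For nonzero \<open>t\<close> the relation expressing X on \<open>f a\<close> is
    transported by the torus. At \<open>t = 0\<close> the columns are multiples of unit vectors and
    admissibility of \<open>q\<close> applies.\<close>
  have X_g: "mat_vec n (X_mat lam) (g t a) \<in> cvec.span (g t ` {1..h a})" if t: "0 \<le> t" and a: "a \<in> {1..n}" for t a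
  proof (cases "t = 0")
    case True
    have X0: "mat_vec n (X_mat lam) (g 0 a) =
        cscale (f a (lab (q a))) (mat_vec n (X_mat lam) (unit_vec lam (q a)))"
      unfolding g_0[OF a] by (rule mat_vec_scale)
    show ?thesis
    proof (cases "left_box (q a)")
      case None
      then have "mat_vec n (X_mat lam) (g t a) = 0"
        unfolding True X0 by (intro ext) (simp add: mat_vec_unit_vec[OF box[OF a]])
      then show ?thesis by (simp add: cvec.span_zero)
    next
      case (Some b)
      then obtain a' where a': "a' \<in> {1..h a}" "b = q a'" using left[OF a Some] by auto
      then have a'n: "a' \<in> {1..n}" using h_le[OF a] by auto
      have "mat_vec n (X_mat lam) (g t a) = cscale (f a (lab (q a)) / f a' (lab (q a'))) (g t a')"
        unfolding True X0 g_0[OF a'n] using Some nz[OF a'n]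
        by (simp add: mat_vec_unit_vec[OF box[OF a]] a'(2))
      also have "\<dots> \<in> cvec.span (g t ` {1..h a})"
        using a'(1) by (intro cvec.span_scale cvec.span_base) auto
      finally show ?thesis .
    qed
  next
    case False
    obtain c where c: "\<And>k. mat_vec n (X_mat lam) (f a) k = (\<Sum>a'\<in>{1..h a}. c a' * f a' k)"
      using span_image_obtain_coeffs[OF _ Xf[OF a]] by blast
    let ?t = "complex_of_real t"
    have g_t: "g t a' (lab b) = ?t ^ weight b / ?t ^ weight (q a') * f a' (lab b)"
      if "a' \<in> {1..n}" "b \<in> boxes lam" for a' b
    proof (cases "weight b < weight (q a')")
      case True
      then show ?thesis using lead[OF that(1)] that(2) by (simp add: g_lab is_lead_def)
    next
      case False
      then show ?thesis using \<open>t \<noteq> 0\<close> that(2) by (simp add: g_lab power_diff)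
    qed
    have ha: "{1..h a} \<subseteq> {1..n}" using h_le[OF a] by auto
    \<comment> \<open>The factor \<open>?t\<close> comes from the weight drop under X, the
      denominator from normalizing column \<open>a\<close>; the last power undoes the normalization
      of column \<open>a'\<close>.\<close>
    let ?d = "\<lambda>a'. ?t / ?t ^ weight (q a) * (c a' * ?t ^ weight (q a'))"
    have "mat_vec n (X_mat lam) (g t a) = (\<lambda>k. \<Sum>a'\<in>{1..h a}. ?d a' * g t a' k)"
    proof (rule cspace_eqI[OF mat_vec_cspace])
      show "(\<lambda>k. \<Sum>a'\<in>{1..h a}. ?d a' * g t a' k) \<in> cspace n"
        using g_frame[of t] ha by (auto simp: cspace_def frames_def intro!: sum.neutral)
      fix b assume b: "b \<in> boxes lam"
      obtain r j where rj: "b = (r, j)" by fastforce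
      have "mat_vec n (X_mat lam) (g t a) (lab b) =
          ?t / ?t ^ weight (q a) * ?t ^ weight b * mat_vec n (X_mat lam) (f a) (lab b)"
        using b g_t[OF a, of "(r, Suc j)"] by (simp add: rj mat_vec_lab weight_Suc)
      also have "\<dots> = (\<Sum>a'\<in>{1..h a}. ?d a' * g t a' (lab b))"
        unfolding c sum_distrib_left
        by (rule sum.cong) (use ha b \<open>t \<noteq> 0\<close> in \<open>auto simp: g_t field_simps\<close>)
      finally show "mat_vec n (X_mat lam) (g t a) (lab b) = (\<Sum>a'\<in>{1..h a}. ?d a' * g t a' (lab b))" .
    qed
    then show ?thesis by (simp only: lincomb_in_span)
  qed
  have "connected_component_of Hess_topology (flag_of n (g 0)) (flag_of n (g 1))"
  proof (rule flag_of_path_connected_component)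
    show "continuous_on {0..1} (\<lambda>t. g t a k)" for a k
      unfolding g_def by (intro continuous_intros)
    show "flag_of n (g t) \<in> Hess n (X_mat lam) h" if "t \<in> {0..1}" for t
    proof (rule flag_of_in_Hess[OF g_frame h_mono h_le])
      show "mat_vec n (X_mat lam) (g t a) \<in> cvec.span (g t ` {1..h a})" if "a \<in> {1..n}" for a
        using X_g[OF _ that] \<open>t \<in> {0..1}\<close> by simp
    qed
  qed (rule g_frame)
  then have "connected_component_of Hess_topology (coord_flag q) V"
    unfolding g0 g1 fV .
  with adm show ?thesis by (rule that)
qed

subsection \<open>Connecting coordinate flags\<close>

text \<open>All exchanged pairs rotate at once. In the first alternative of \<open>left\<close>, X
  carries column \<open>a\<close> of the rotating frame to column \<open>a0\<close>. In the second,
  the left neighbours and their partners come early enough for the whole planes they span to lie in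
  the required space.\<close>

lemma involution_connects:
  assumes adm: "admissible q"
    and pi_box: "\<And>b. b \<in> boxes lam \<Longrightarrow> \<pi> b \<in> boxes lam" and pi_pi: "\<And>b. b \<in> boxes lam \<Longrightarrow> \<pi> (\<pi> b) = b"
    and left: "\<And>a. a \<in> {1..n} \<Longrightarrow>
      (\<exists>a0\<in>{1..h a}. left_box (q a) = Some (q a0) \<and> left_box (\<pi> (q a)) = Some (\<pi> (q a0))) \<or>
      (\<forall>b. left_box (q a) = Some b \<or> left_box (\<pi> (q a)) = Some b \<longrightarrow>
        b \<in> q ` {1..h a} \<and> \<pi> b \<in> q ` {1..h a})"
  shows "admissible (\<pi> \<circ> q)"
    and "connected_component_of Hess_topology (coord_flag q) (coord_flag (\<pi> \<circ> q))"
proof -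
  have bij: "bij_betw q {1..n} (boxes lam)" using adm by (simp add: admissible_def)
  have box: "q a \<in> boxes lam" if "a \<in> {1..n}" for a using bij that by (auto simp: bij_betw_def)
  have q_eq: "q a = q a' \<longleftrightarrow> a = a'" if "a \<in> {1..n}" "a' \<in> {1..n}" for a a'
    using inj_on_eq_iff[OF bij_betw_imp_inj_on[OF bij] that] .
  have pi_bij: "bij_betw \<pi> (boxes lam) (boxes lam)"
    by (rule bij_betw_byWitness[where f' = \<pi>]) (use pi_box pi_pi in auto)
  have "b \<in> (\<pi> \<circ> q) ` {1..h a}" if a: "a \<in> {1..n}" and b: "left_box (\<pi> (q a)) = Some b" for a b
    using left[OF a]
  proof
    assume "\<exists>a0\<in>{1..h a}. left_box (q a) = Some (q a0) \<and> left_box (\<pi> (q a)) = Some (\<pi> (q a0))"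
    then show ?thesis using b by auto
  next
    assume "\<forall>b. left_box (q a) = Some b \<or> left_box (\<pi> (q a)) = Some b \<longrightarrow>
        b \<in> q ` {1..h a} \<and> \<pi> b \<in> q ` {1..h a}"
    then obtain a' where a': "a' \<in> {1..h a}" "\<pi> b = q a'" using b by blast
    have "\<pi> (\<pi> b) = b" using pi_pi left_box_in_boxes[OF pi_box[OF box[OF a]] b] .
    then have "b = (\<pi> \<circ> q) a'" using a'(2) by simp
    then show ?thesis using a'(1) by (rule image_eqI)
  qed
  then show "admissible (\<pi> \<circ> q)"
    using bij_betw_trans[OF bij pi_bij] by (simp add: admissible_def)
  define E where "E = unit_vec lam"
  \<comment> \<open>The factor \<open>\<i>\<close> makes the transition matrix of each exchanged pair invertible for all real \<open>t\<close>, and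
    lets boxes fixed by \<open>\<pi>\<close> be treated uniformly.\<close>
  define g :: "real \<Rightarrow> nat \<Rightarrow> nat \<Rightarrow> complex" where
    "g t a = (if a \<in> {1..n}
       then cscale (1 - of_real t) (E (q a)) + cscale (\<i> * of_real t) (E (\<pi> (q a))) else 0)" for t a
  have g: "g t a = cscale (1 - of_real t) (E (q a)) + cscale (\<i> * of_real t) (E (\<pi> (q a)))"
    if "a \<in> {1..n}" for t a using that by (simp add: g_def)
  \<comment> \<open>This is the determinant of the matrix with diagonal entries \<open>1 - t\<close>
    and off-diagonal entries \<open>\<i> * t\<close>; the two real squares never vanish
    together.\<close>
  have det: "(1 - of_real t)\<^sup>2 + (of_real t)\<^sup>2 \<noteq> (0 :: complex)" for t
  proof -
    have "(1 - t)\<^sup>2 + t\<^sup>2 \<noteq> 0" by (auto simp: sum_power2_eq_zero_iff)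
    then have "complex_of_real ((1 - t)\<^sup>2 + t\<^sup>2) \<noteq> 0" by (simp only: of_real_eq_0_iff not_False_eq_True)
    then show ?thesis by simp
  qed
  \<comment> \<open>One row of the adjugate times that matrix. It serves both to solve for
    coefficients and to recover unit vectors.\<close>
  have rotation: "(1 - s) * ((1 - s) * x + \<i> * s * y) - \<i> * s * ((1 - s) * y + \<i> * s * x) =
      ((1 - s)\<^sup>2 + s\<^sup>2) * x" for s x y :: complex
    by (simp add: algebra_simps power2_eq_square)
  have g_frame: "g t \<in> frames n" for t
  proof (rule framesI)
    show "g t a \<in> cspace n" if "a \<in> {1..n}" for a
      using unit_vec_cspace[OF box[OF that]] unit_vec_cspace[OF pi_box[OF box[OF that]]]
      unfolding g[OF that] E_def by (auto simp: cspace_def)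
    show "g t a = 0" if "a \<notin> {1..n}" for a using that by (auto simp: g_def)
    fix c :: "nat \<Rightarrow> complex" and a
    assume z: "\<And>k. (\<Sum>a\<in>{1..n}. c a * g t a k) = 0" and a: "a \<in> {1..n}"
    \<comment> \<open>Read the relation at the box \<open>q a1\<close>: it occurs only in column
      \<open>a1\<close> and in the column \<open>a2\<close> of its partner. For a box fixed by \<pi>
      both terms come from the same column.\<close>
    have *: "(1 - of_real t) * c a1 + \<i> * of_real t * c a2 = 0"
      if "a1 \<in> {1..n}" "a2 \<in> {1..n}" "q a2 = \<pi> (q a1)" for a1 a2
    proof -
      have pi_eq: "q a1 = \<pi> (q a) \<longleftrightarrow> a = a2" if "a \<in> {1..n}" for a
      proof
        assume "q a1 = \<pi> (q a)"
        then have "q a = q a2" unfolding \<open>q a2 = \<pi> (q a1)\<close> using pi_pi[OF box[OF that]] by simp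
        then show "a = a2" using q_eq[OF that \<open>a2 \<in> {1..n}\<close>] by simp
      next
        assume "a = a2"
        then show "q a1 = \<pi> (q a)" using \<open>q a2 = \<pi> (q a1)\<close> pi_pi[OF box[OF \<open>a1 \<in> {1..n}\<close>]] by simp
      qed
      have E2: "E (\<pi> (q a)) (lab (q a1)) = (if a = a2 then 1 else 0)" if "a \<in> {1..n}" for a
        unfolding E_def unit_vec_lab[OF pi_box[OF box[OF that]] box[OF \<open>a1 \<in> {1..n}\<close>]]
        using pi_eq[OF that] by (simp only: eq_commute)
      have E1: "E (q a) (lab (q a1)) = (if a = a1 then 1 else 0)" if "a \<in> {1..n}" for a
        unfolding E_def unit_vec_lab[OF box[OF that] box[OF \<open>a1 \<in> {1..n}\<close>]]
        using q_eq[OF \<open>a1 \<in> {1..n}\<close> that] by (simp only: eq_commute)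
      have "c a * g t a (lab (q a1)) =
          (if a = a1 then (1 - of_real t) * c a1 else 0) + (if a = a2 then \<i> * of_real t * c a2 else 0)"
        if "a \<in> {1..n}" for a
        unfolding g[OF that] plus_fun_apply E1[OF that] E2[OF that] by (simp add: algebra_simps)
      then have "(\<Sum>a\<in>{1..n}. c a * g t a (lab (q a1))) =
          (\<Sum>a\<in>{1..n}. (if a = a1 then (1 - of_real t) * c a1 else 0) + (if a = a2 then \<i> * of_real t * c a2 else 0))"
        by (intro sum.cong refl)
      also have "\<dots> = (1 - of_real t) * c a1 + \<i> * of_real t * c a2"
        unfolding sum.distrib using that by simp
      finally show ?thesis using z by simp
    qed
    have "\<pi> (q a) \<in> q ` {1..n}" using pi_box[OF box[OF a]] bij by (simp add: bij_betw_def)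
    then obtain a' where a': "a' \<in> {1..n}" "q a' = \<pi> (q a)" by auto
    have "q a = \<pi> (q a')" using a' pi_pi[OF box[OF a]] by simp
    \<comment> \<open>The equations at a box and at its partner form a homogeneous 2 by 2 system;
      \<open>rotation\<close> eliminates \<open>c a'\<close>.\<close>
    note eqs = *[OF a a'] *[OF a'(1) a this]
    from rotation[of "of_real t" "c a" "c a'"] show "c a = 0" unfolding eqs using det[of t] by simp
  qed
  \<comment> \<open>If a box and its partner are both among the first \<open>m\<close>, inverting
    the 2 by 2 matrix recovers the unit vector at every time \<open>t\<close>.\<close>
  have E_span: "E b \<in> cvec.span (g t ` {1..m})"
    if "m \<le> n" "b \<in> boxes lam" "b \<in> q ` {1..m}" "\<pi> b \<in> q ` {1..m}" for t b m
  proof -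
    obtain a1 a2 where a: "a1 \<in> {1..m}" "b = q a1" "a2 \<in> {1..m}" "\<pi> b = q a2" 
      using \<open>b \<in> q ` {1..m}\<close> \<open>\<pi> b \<in> q ` {1..m}\<close> by (elim imageE)
    then have an: "a1 \<in> {1..n}" "a2 \<in> {1..n}" using \<open>m \<le> n\<close> by auto
    let ?D = "(1 - of_real t)\<^sup>2 + (of_real t)\<^sup>2 :: complex"
    let ?x = "cscale (1 - of_real t) (g t a1) - cscale (\<i> * of_real t) (g t a2)"
    have x: "?x = cscale ?D (E b)"
      unfolding g[OF an(1)] g[OF an(2)] a(2,4)[symmetric]
      unfolding pi_pi[OF \<open>b \<in> boxes lam\<close>] by (intro ext) (simp only: fun_diff_def plus_fun_def rotation)
    have "E b = cscale (1 / ?D) ?x" unfolding x using det[of t] by simp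
    also have "\<dots> \<in> cvec.span (g t ` {1..m})"
      using a by (intro cvec.span_scale cvec.span_diff cvec.span_base) auto
    finally show ?thesis .
  qed
  have X_E: "mat_vec n (X_mat lam) (E b) = (case left_box b of None \<Rightarrow> 0 | Some b0 \<Rightarrow> E b0)"
    if "b \<in> boxes lam" for b
    unfolding E_def by (rule mat_vec_unit_vec[OF that])
  have X_g: "mat_vec n (X_mat lam) (g t a) \<in> cvec.span (g t ` {1..h a})" if a: "a \<in> {1..n}" for t a
  proof -
    have X: "mat_vec n (X_mat lam) (g t a) = cscale (1 - of_real t) (mat_vec n (X_mat lam) (E (q a)))
        + cscale (\<i> * of_real t) (mat_vec n (X_mat lam) (E (\<pi> (q a))))"
      unfolding g[OF a] mat_vec_add mat_vec_scale ..
    from left[OF a] show ?thesis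
    proof
      assume "\<exists>a0\<in>{1..h a}. left_box (q a) = Some (q a0) \<and> left_box (\<pi> (q a)) = Some (\<pi> (q a0))"
      then obtain a0 where a0: "a0 \<in> {1..h a}" "left_box (q a) = Some (q a0)" "left_box (\<pi> (q a)) = Some (\<pi> (q a0))"
        by blast
      then have "a0 \<in> {1..n}" using h_le[OF a] by auto
      then have "mat_vec n (X_mat lam) (g t a) = g t a0"
        unfolding X X_E[OF box[OF a]] X_E[OF pi_box[OF box[OF a]]] a0(2,3) by (simp add: g)
      then show ?thesis using a0(1) by (simp add: cvec.span_base)
    next
      assume B: "\<forall>b. left_box (q a) = Some b \<or> left_box (\<pi> (q a)) = Some b \<longrightarrow>
        b \<in> q ` {1..h a} \<and> \<pi> b \<in> q ` {1..h a}"
      have "mat_vec n (X_mat lam) (E b) \<in> cvec.span (g t ` {1..h a})"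
        if b: "b \<in> boxes lam" "b = q a \<or> b = \<pi> (q a)" for b
      proof (cases "left_box b")
        case None
        then show ?thesis by (simp add: X_E[OF b(1)] cvec.span_zero)
      next
        case (Some b0)
        then have "b0 \<in> q ` {1..h a} \<and> \<pi> b0 \<in> q ` {1..h a}" using B b(2) by blast
        then show ?thesis
          using E_span[OF h_le[OF a] left_box_in_boxes[OF b(1) Some]] Some by (simp add: X_E[OF b(1)])
      qed
      then show ?thesis
        unfolding X using box[OF a] pi_box[OF box[OF a]]
        by (intro cvec.span_add cvec.span_scale) auto
    qed
  qed
  have conn: "connected_component_of Hess_topology (flag_of n (g 0)) (flag_of n (g 1))"
  proof (rule flag_of_path_connected_component[OF _ g_frame])
    show "continuous_on {0..1} (\<lambda>t. g t a k)" for a k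
      by (cases "a \<in> {1..n}") (auto simp: g_def intro!: continuous_intros)
    show "flag_of n (g t) \<in> Hess n (X_mat lam) h" for t
      by (rule flag_of_in_Hess[OF g_frame h_mono h_le X_g])
  qed
  have "flag_of n (g 0) = coord_flag q"
    by (rule flag_of_rescale[where c = "\<lambda>_. 1"]) (auto simp: g E_def coord_frame_def)
  moreover have "flag_of n (g 1) = coord_flag (\<pi> \<circ> q)"
    by (rule flag_of_rescale[where c = "\<lambda>_. \<i>"]) (auto simp: g E_def coord_frame_def)
  ultimately show "connected_component_of Hess_topology (coord_flag q) (coord_flag (\<pi> \<circ> q))"
    using conn by simp
qed

section \<open>Positions in an admissible enumeration\<close>

definition position :: "(nat \<Rightarrow> nat \<times> nat) \<Rightarrow> nat \<times> nat \<Rightarrow> nat" where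
  "position q = the_inv_into {1..n} q"

context
  fixes q assumes adm: "admissible q"
begin

lemma adm_bij: "bij_betw q {1..n} (boxes lam)"
  using adm by (simp add: admissible_def)

lemma adm_box: "a \<in> {1..n} \<Longrightarrow> q a \<in> boxes lam"
  using adm_bij by (rule bij_betwE[THEN bspec])

lemma position_range: "b \<in> boxes lam \<Longrightarrow> position q b \<in> {1..n}"
  unfolding position_def using bij_betw_the_inv_into[OF adm_bij] by (rule bij_betwE[THEN bspec])

lemma adm_position: "b \<in> boxes lam \<Longrightarrow> q (position q b) = b"
  unfolding position_def using f_the_inv_into_f_bij_betw[OF adm_bij] by simp

lemma position_adm: "a \<in> {1..n} \<Longrightarrow> position q (q a) = a"
  unfolding position_def by (rule the_inv_into_f_f[OF bij_betw_imp_inj_on[OF adm_bij]])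

lemma mem_adm_image: "b \<in> boxes lam \<Longrightarrow> position q b \<le> m \<Longrightarrow> b \<in> q ` {1..m}"
  using adm_position[of b] position_range[of b] by (intro image_eqI[of _ _ "position q b"]) auto

text \<open>Admissibility as an inequality between positions. Since \<open>h a < a\<close>, it makes
  positions increase strictly along each row.\<close>

lemma position_left:
  assumes "(r, Suc c) \<in> boxes lam"
  shows "position q (r, c) \<le> h (position q (r, Suc c))" and "position q (r, c) < position q (r, Suc c)"
proof -
  let ?a = "position q (r, Suc c)"
  have a: "?a \<in> {1..n}" using position_range[OF assms] .
  have "left_box (q ?a) = Some (r, c)" by (simp add: adm_position[OF assms])
  then have "(r, c) \<in> q ` {1..h ?a}" using adm a by (simp add: admissible_def)
  then obtain a' where a': "a' \<in> {1..h ?a}" "(r, c) = q a'" by (rule imageE)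
  then have "a' \<in> {1..n}" using h_le[OF a] by auto
  then have "position q (r, c) = a'" unfolding a'(2) by (rule position_adm)
  then show "position q (r, c) \<le> h ?a" using a'(1) by simp
  then show "position q (r, c) < ?a" using h_less[OF a] by simp
qed

lemma position_row_mono:
  "(r, c + k) \<in> boxes lam \<Longrightarrow> position q (r, c) \<le> position q (r, c + k)"
proof (induction k)
  case (Suc k)
  then have "(r, c + k) \<in> boxes lam" by (simp add: boxes_def)
  from Suc.IH[OF this] position_left(2)[of r "c + k"] Suc.prems show ?case by simp
qed simp

end

text \<open>The hypothesis \<open>len\<close> avoids truncated subtraction: the row tail from
  \<open>(r, c)\<close> is at least as long as that from \<open>(r', c')\<close>, so every box of
  the latter has a counterpart.\<close>

lemma exchange_tails:
  assumes adm: "admissible q" and adm': "admissible q'" and i: "i \<in> {1..n}"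
    and agree: "\<And>a. a \<in> {1..<i} \<Longrightarrow> q a = q' a" and neq: "q i \<noteq> q' i"
    and qi: "q i = (r', c')" and q'i: "q' i = (r, c)"
    and len: "lam ! r' + c \<le> lam ! r + c'"
  shows "\<exists>q1. admissible q1 \<and> (\<forall>a\<in>{1..i}. q1 a = q' a) \<and>
    connected_component_of Hess_topology (coord_flag q) (coord_flag q1)"
proof -
  define S where "S k = position q (r', c' + k)" for k
  define T where "T k = position q (r, c + k)" for k
  have b0: "(r', c') \<in> boxes lam" "(r, c) \<in> boxes lam"
    using adm_box[OF adm i] adm_box[OF adm' i] by (simp_all add: qi q'i)
  have box': "(r, c + k) \<in> boxes lam" if "(r', c' + k) \<in> boxes lam" for k
    using that b0 len by (simp add: boxes_def)
  have S0: "S 0 = i" unfolding S_def using position_adm[OF adm i] by (simp add: qi)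
  \<comment> \<open>Before \<open>i\<close> the enumerations agree and \<open>q'\<close> places
    \<open>(r, c)\<close> only at \<open>i\<close>; at \<open>i\<close> itself they differ.\<close>
  have T0: "i < T 0"
  proof (rule ccontr)
    assume "\<not> i < T 0"
    moreover have T: "T 0 \<in> {1..n}" "q (T 0) = (r, c)"
      unfolding T_def using position_range[OF adm b0(2)] adm_position[OF adm b0(2)] by simp_all
    ultimately have "T 0 \<in> {1..<i} \<or> T 0 = i" by auto
    then show False
    proof
      assume *: "T 0 \<in> {1..<i}"
      then have "q' (T 0) = q' i" using agree T(2) by (simp add: q'i)
      then have "T 0 = i" using inj_onD[OF bij_betw_imp_inj_on[OF adm_bij[OF adm']] _ T(1) i] by simp
      with * show False by simp
    next
      assume "T 0 = i"
      with T(2) neq show False by (simp add: q'i)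
    qed
  qed
  have S_ge: "i \<le> S k" if "(r', c' + k) \<in> boxes lam" for k
    using position_row_mono[OF adm that] S0 by (simp add: S_def)
  have T_gt: "i < T k" if "(r, c + k) \<in> boxes lam" for k
    using position_row_mono[OF adm that] T0 by (simp add: T_def)
  have S_Suc: "S k \<le> h (S (Suc k))" if "(r', c' + Suc k) \<in> boxes lam" for k
    using position_left(1)[OF adm, of r' "c' + k"] that by (simp add: S_def)
  have T_Suc: "T k \<le> h (T (Suc k))" if "(r, c + Suc k) \<in> boxes lam" for k
    using position_left(1)[OF adm, of r "c + k"] that by (simp add: T_def)
  \<comment> \<open>In a common row, \<open>c \<le> c'\<close> would make \<open>q\<close> list
    \<open>(r, c)\<close> no later than \<open>i\<close>. Otherwise \<open>q'\<close> lists
    \<open>(r, c')\<close> before \<open>i\<close>, where it agrees with \<open>q\<close>, but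
    \<open>q\<close> lists that box at \<open>i\<close>.\<close>
  have rows: "r \<noteq> r'"
  proof
    assume r: "r = r'"
    show False
    proof (cases "c \<le> c'")
      case True
      then have "(r, c + (c' - c)) \<in> boxes lam" using b0 r by simp
      from T_gt[OF this] True show False using S0 r by (simp add: T_def S_def)
    next
      case False
      have pos': "position q' (r, c) = i" using position_adm[OF adm' i] by (simp add: q'i)
      have "(r, Suc (c' + (c - Suc c'))) \<in> boxes lam" using b0 False by simp
      moreover from this have "(r, c' + (c - Suc c')) \<in> boxes lam" by (simp add: boxes_def)
      ultimately have "position q' (r, c') < position q' (r, Suc (c' + (c - Suc c')))"
        using position_left(2)[OF adm'] position_row_mono[OF adm'] by (metis le_less_trans)
      then have lt: "position q' (r, c') < i" using False pos' by simp
      have b: "(r, c') \<in> boxes lam" using b0 r by simp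
      have "q' (position q' (r, c')) = (r, c')" by (rule adm_position[OF adm' b])
      then have "q (position q' (r, c')) = q i"
        using agree[of "position q' (r, c')"] lt position_range[OF adm' b] by (simp add: qi r)
      then have "position q' (r, c') = i"
        using inj_onD[OF bij_betw_imp_inj_on[OF adm_bij[OF adm]] _ position_range[OF adm' b] i] by simp
      with lt show False by simp
    qed
  qed
  \<comment> \<open>Admissibility of \<open>q\<close> bounds this position only by
    \<open>h (T 0)\<close>. The sharper bound comes from \<open>q'\<close>, which has
    \<open>(r, c)\<close> at \<open>i\<close> and agrees with \<open>q\<close> on the first
    \<open>h i < i\<close> places.\<close>
  have left_rc: "position q (r, c0) \<le> h i" if "c = Suc c0" for c0
  proof -
    have "left_box (q' i) = Some (r, c0)" by (simp add: q'i that)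
    then have "(r, c0) \<in> q' ` {1..h i}" using adm' i by (simp add: admissible_def)
    then obtain a where a: "a \<in> {1..h i}" "(r, c0) = q' a" by (rule imageE)
    then have "a \<in> {1..<i}" using h_less[OF i] by simp
    then have "q a = (r, c0)" using agree a(2) by simp
    moreover have "a \<in> {1..n}" using \<open>a \<in> {1..<i}\<close> i by simp
    ultimately have "position q (r, c0) = a" using position_adm[OF adm, of a] by simp
    then show ?thesis using a(1) by simp
  qed
  \<comment> \<open>\<open>K k\<close> selects the pairs to exchange. The guards in \<pi> keep the
    subtractions exact, and as the rows differ its two branches exclude each other.\<close>
  define K where "K k \<longleftrightarrow> (r', c' + k) \<in> boxes lam \<and> S k < T k" for k
  define \<pi> where "\<pi> b =
    (if fst b = r' \<and> c' \<le> snd b \<and> K (snd b - c') then (r, c + (snd b - c'))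
     else if fst b = r \<and> c \<le> snd b \<and> K (snd b - c) then (r', c' + (snd b - c)) else b)" for b
  have pi1: "\<pi> (r', c' + k) = (if K k then (r, c + k) else (r', c' + k))" for k
    using rows by (simp add: \<pi>_def)
  have pi2: "\<pi> (r, c + k) = (if K k then (r', c' + k) else (r, c + k))" for k
    using rows by (simp add: \<pi>_def)
  have pi_cases: "(\<exists>k. K k \<and> b = (r', c' + k)) \<or> (\<exists>k. K k \<and> b = (r, c + k)) \<or> \<pi> b = b" for b
  proof (cases b)
    case (Pair x y)
    consider "x = r' \<and> c' \<le> y \<and> K (y - c')" | "x = r \<and> c \<le> y \<and> K (y - c)"
      | "\<not> (x = r' \<and> c' \<le> y \<and> K (y - c'))" "\<not> (x = r \<and> c \<le> y \<and> K (y - c))" by blast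
    then show ?thesis
    proof cases
      case 1
      then have "K (y - c') \<and> b = (r', c' + (y - c'))" using Pair by simp
      then show ?thesis by blast
    next
      case 2
      then have "K (y - c) \<and> b = (r, c + (y - c))" using Pair by simp
      then show ?thesis by blast
    next
      case 3
      then have "\<pi> b = b" unfolding \<pi>_def Pair by (simp only: fst_conv snd_conv if_False)
      then show ?thesis by blast
    qed
  qed
  have pi_low: "\<pi> (r', c0) = (r', c0)" if "c' = Suc c0" for c0
    using rows that by (simp add: \<pi>_def)
  have pi_low': "\<pi> (r, c0) = (r, c0)" if "c = Suc c0" for c0
    using rows that by (simp add: \<pi>_def)
  have K_box: "(r', c' + k) \<in> boxes lam" "(r, c + k) \<in> boxes lam" if "K k" for k
    using that box' by (simp_all add: K_def)
  have pi_box: "\<pi> b \<in> boxes lam" if "b \<in> boxes lam" for b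
    using pi_cases[of b] that K_box pi1 pi2 by auto
  have pi_pi: "\<pi> (\<pi> b) = b" for b
    using pi_cases[of b] pi1 pi2 by auto
  have left: "(\<exists>a0\<in>{1..h a}. left_box (q a) = Some (q a0) \<and> left_box (\<pi> (q a)) = Some (\<pi> (q a0))) \<or>
      (\<forall>b. left_box (q a) = Some b \<or> left_box (\<pi> (q a)) = Some b \<longrightarrow>
        b \<in> q ` {1..h a} \<and> \<pi> b \<in> q ` {1..h a})" (is "?A a \<or> ?B a") if a: "a \<in> {1..n}" for a
  proof -
    have box: "q a \<in> boxes lam" by (rule adm_box[OF adm a])
    have pos: "position q (q a) = a" by (rule position_adm[OF adm a])
    \<comment> \<open>Both boxes of an exchanged pair come at \<open>S k\<close> or later, so bounds
      by \<open>h (S k)\<close> serve for both. At \<open>k = 0\<close> the left neighbours lie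
      outside the tails and are fixed by \<pi>.\<close>
    have moved: "?A a \<or> ?B a"
      if k: "K k" and qa: "q a = (r', c' + k) \<or> q a = (r, c + k)" for k
    proof -
      have Sk: "S k < T k" and bk: "(r', c' + k) \<in> boxes lam" "(r, c + k) \<in> boxes lam"
        using k box' by (simp_all add: K_def)
      have a_eq: "a = S k \<and> q a = (r', c' + k) \<or> a = T k \<and> q a = (r, c + k)"
        using qa pos by (auto simp: S_def T_def)
      then have "S k \<le> a" using Sk by auto
      moreover have "S k \<in> {1..n}" unfolding S_def by (rule position_range[OF adm bk(1)])
      ultimately have hS: "h (S k) \<le> h a" using a by (intro h_monoD) auto
      have lefts: "left_box (q a) = Some b \<or> left_box (\<pi> (q a)) = Some b \<Longrightarrow>
          left_box (r', c' + k) = Some b \<or> left_box (r, c + k) = Some b" for b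
        using qa k pi1[of k] pi2[of k] by auto
      show ?thesis
      proof (cases k)
        case 0
        have "b \<in> boxes lam \<and> position q b \<le> h a \<and> \<pi> b = b"
          if "left_box (r', c' + k) = Some b \<or> left_box (r, c + k) = Some b" for b
          using that
        proof
          assume b: "left_box (r', c' + k) = Some b"
          then obtain c0 where c0: "c' = Suc c0" "b = (r', c0)" using 0 by (cases c') auto
          have "position q b \<le> h (S k)"
            using position_left(1)[OF adm, of r' c0] b0(1) 0 c0 by (simp add: S_def)
          then show ?thesis using left_box_in_boxes[OF bk(1) b] hS pi_low[OF c0(1)] c0(2) by simp
        next
          assume b: "left_box (r, c + k) = Some b"
          then obtain c0 where c0: "c = Suc c0" "b = (r, c0)" using 0 by (cases c) auto
          have "position q b \<le> h (S k)" using left_rc[OF c0(1)] S0 0 c0 by simp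
          then show ?thesis using left_box_in_boxes[OF bk(2) b] hS pi_low'[OF c0(1)] c0(2) by simp
        qed
        then have "?B a" using lefts mem_adm_image[OF adm] by (metis (no_types))
        then show ?thesis ..
      next
        case (Suc j)
        have bj: "(r', c' + j) \<in> boxes lam" "(r, c + j) \<in> boxes lam"
          using bk Suc by (simp_all add: boxes_def)
        have lk: "left_box (r', c' + k) = Some (r', c' + j)" "left_box (r, c + k) = Some (r, c + j)"
          by (simp_all add: Suc)
        show ?thesis
        proof (cases "K j")
          case True
          from a_eq have "?A a"
          proof
            assume *: "a = S k \<and> q a = (r', c' + k)"
            have "S j \<in> {1..h a}"
              using S_Suc[of j] bk(1) position_range[OF adm bj(1)] * Suc by (simp add: S_def)
            moreover have "q (S j) = (r', c' + j)" unfolding S_def by (rule adm_position[OF adm bj(1)])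
            ultimately show ?thesis using k True lk by (intro bexI[of _ "S j"]) (simp_all add: *[THEN conjunct2] pi1)
          next
            assume *: "a = T k \<and> q a = (r, c + k)"
            have "T j \<in> {1..h a}"
              using T_Suc[of j] bk(2) position_range[OF adm bj(2)] * Suc by (simp add: T_def)
            moreover have "q (T j) = (r, c + j)" unfolding T_def by (rule adm_position[OF adm bj(2)])
            ultimately show ?thesis using k True lk by (intro bexI[of _ "T j"]) (simp_all add: *[THEN conjunct2] pi2)
          qed
          then show ?thesis ..
        next
          case False
          \<comment> \<open>If the preceding pair stays in place, its later member is at
            \<open>S j\<close>, which is at most \<open>h (S k)\<close>; so both members are
            available and the second alternative holds.\<close>
          then have "T j \<le> S j" using bj by (simp add: K_def)
          moreover have "S j \<le> h a" using S_Suc[of j] bk(1) Suc hS by simp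
          ultimately have "position q (r', c' + j) \<le> h a" "position q (r, c + j) \<le> h a"
            by (simp_all add: S_def T_def)
          then have "(r', c' + j) \<in> q ` {1..h a}" "(r, c + j) \<in> q ` {1..h a}"
            using bj by (blast intro: mem_adm_image[OF adm])+
          moreover have "\<pi> (r', c' + j) = (r', c' + j)" "\<pi> (r, c + j) = (r, c + j)"
            using False pi1 pi2 by simp_all
          moreover have "b = (r', c' + j) \<or> b = (r, c + j)"
            if "left_box (q a) = Some b \<or> left_box (\<pi> (q a)) = Some b" for b
            using lefts[OF that] unfolding lk by auto
          ultimately have "?B a" by (metis (no_types))
          then show ?thesis ..
        qed
      qed
    qed
    have fixed: "?B a" if stays: "\<pi> (q a) = q a" and nK: "\<And>k. K k \<Longrightarrow> q a \<noteq> (r', c' + k)"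
    proof -
      have "b \<in> q ` {1..h a} \<and> \<pi> b \<in> q ` {1..h a}" if b: "left_box (q a) = Some b" for b
      proof -
        have bb: "b \<in> boxes lam" by (rule left_box_in_boxes[OF box b])
        have qa: "q a = (fst b, Suc (snd b))" using b by (simp add: left_box_eq_Some)
        have pb: "position q b \<le> h a"
          using position_left(1)[OF adm, of "fst b" "snd b"] box pos unfolding qa by simp
        \<comment> \<open>Only a moved left neighbour matters. If it is in the tail of
          \<open>(r', c')\<close>, the next pair is not exchanged, so
          \<open>T (Suc j) \<le> a\<close> and hence \<open>T j \<le> h a\<close>. If it is in the
          other tail, its partner comes even earlier.\<close>
        have "position q (\<pi> b) \<le> h a"
          using pi_cases[of b]
        proof (elim disjE exE conjE)
          fix j assume j: "K j" "b = (r', c' + j)"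
          then have qaj: "q a = (r', c' + Suc j)" using qa by simp
          then have "\<not> K (Suc j)" using nK by blast
          moreover have bS: "(r', c' + Suc j) \<in> boxes lam" using box unfolding qaj .
          ultimately have "T (Suc j) \<le> S (Suc j)" by (simp add: K_def)
          also have "S (Suc j) = a" using pos unfolding qaj S_def .
          finally have "h (T (Suc j)) \<le> h a"
            using a position_range[OF adm box'[OF bS]] by (intro h_monoD) (auto simp: T_def)
          then have "T j \<le> h a" using T_Suc[OF box'[OF bS]] by simp
          then show ?thesis using j pi1 by (simp add: T_def)
        next
          fix j assume j: "K j" "b = (r, c + j)"
          then have "S j < T j" by (simp add: K_def)
          then show ?thesis using pb j pi2 by (simp add: S_def T_def)
        qed (use pb in simp)
        with pb show ?thesis by (intro conjI mem_adm_image[OF adm] bb pi_box)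
      qed
      then show ?thesis unfolding stays by blast
    qed
    show ?thesis
    proof (cases "\<exists>k. K k \<and> (q a = (r', c' + k) \<or> q a = (r, c + k))")
      case True
      then obtain k where "K k" "q a = (r', c' + k) \<or> q a = (r, c + k)" by blast
      then show ?thesis by (rule moved)
    next
      case False
      then have "\<pi> (q a) = q a" using pi_cases[of "q a"] by blast
      then have "?B a" by (rule fixed) (use False in blast)
      then show ?thesis ..
    qed
  qed
  \<comment> \<open>Exchanged boxes occur in \<open>q\<close> only from \<open>i\<close> on, so
    earlier entries are untouched; at \<open>i\<close> the pair \<open>k = 0\<close> is exchanged,
    because \<open>S 0 = i < T 0\<close>.\<close>
  have agree1: "(\<pi> \<circ> q) a = q' a" if a: "a \<in> {1..i}" for a
  proof (cases "a = i")
    case True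
    have "K 0" using S0 T0 b0 by (simp add: K_def)
    then show ?thesis using pi1[of 0] by (simp add: True qi q'i)
  next
    case False
    then have ai: "a \<in> {1..<i}" "a \<in> {1..n}" using a i by auto
    have pos: "position q (q a) = a" by (rule position_adm[OF adm ai(2)])
    have "\<pi> (q a) = q a"
      using pi_cases[of "q a"]
    proof (elim disjE exE conjE)
      fix k assume k: "K k" "q a = (r', c' + k)"
      then have "a = S k" using pos by (simp add: S_def)
      then show ?thesis using S_ge[OF K_box(1)[OF k(1)]] ai by simp
    next
      fix k assume k: "K k" "q a = (r, c + k)"
      then have "a = T k" using pos by (simp add: T_def)
      then show ?thesis using T_gt[OF K_box(2)[OF k(1)]] ai by simp
    qed
    then show ?thesis using agree[OF ai(1)] by simp
  qed
  from involution_connects[OF adm pi_box pi_pi left] agree1 show ?thesis by blast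
qed

text \<open>Downward induction on the length of disagreement: each exchange lengthens the common
  initial segment by one, until all \<open>n\<close> places agree.\<close>

lemma coord_flags_connected:
  assumes "i \<le> Suc n" "1 \<le> i" "admissible q" "admissible q'" "\<And>a. a \<in> {1..<i} \<Longrightarrow> q a = q' a"
  shows "connected_component_of Hess_topology (coord_flag q) (coord_flag q')"
  using assms
proof (induction i arbitrary: q q' rule: inc_induct)
  case base
  have "coord_frame q = coord_frame q'" using base(4) by (intro ext) (auto simp: coord_frame_def)
  \<comment> \<open>The relation is reflexive only on points of the variety; the trivial involution
    \<open>id\<close> supplies this instance.\<close>
  moreover have "connected_component_of Hess_topology (coord_flag q) (coord_flag (id \<circ> q))"
    by (rule involution_connects(2)[OF base(2)]) (use base(2) in \<open>simp_all add: admissible_def\<close>)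
  ultimately show ?case by simp
next
  case (step i)
  have i: "i \<in> {1..n}" using step by simp
  show ?case
  proof (cases "q i = q' i")
    case True
    then have "q a = q' a" if "a \<in> {1..<Suc i}" for a
      using step.prems(4) that by (cases "a = i") auto
    then show ?thesis using step by simp
  next
    case False
    obtain r' c' r c where rc: "q i = (r', c')" "q' i = (r, c)" by (metis surj_pair)
    \<comment> \<open>The enumeration to modify is the one whose box at \<open>i\<close> has the
      shorter row tail; the component relation is symmetric.\<close>
    consider "lam ! r' + c \<le> lam ! r + c'" | "lam ! r + c' \<le> lam ! r' + c" by linarith
    then show ?thesis
    proof cases
      case 1
      obtain q1 where q1: "admissible q1" "\<forall>a\<in>{1..i}. q1 a = q' a"
        "connected_component_of Hess_topology (coord_flag q) (coord_flag q1)"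
        using exchange_tails[OF step.prems(2,3) i step.prems(4) False rc 1] by blast
      have "connected_component_of Hess_topology (coord_flag q1) (coord_flag q')"
        by (rule step.IH) (use q1 step.prems in auto)
      then show ?thesis by (rule connected_component_of_trans[OF q1(3)])
    next
      case 2
      obtain q1 where q1: "admissible q1" "\<forall>a\<in>{1..i}. q1 a = q a"
        "connected_component_of Hess_topology (coord_flag q') (coord_flag q1)"
        using exchange_tails[OF step.prems(3,2) i step.prems(4)[symmetric] False[symmetric] rc(2,1) 2] by blast
      have "connected_component_of Hess_topology (coord_flag q) (coord_flag q1)"
        by (rule step.IH) (use q1 step.prems in auto)
      then show ?thesis
        by (rule connected_component_of_trans[OF _ q1(3)[THEN connected_component_of_sym[THEN iffD1]]])
    qed
  qed
qed

end

theorem theorem6p5: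
  fixes n :: nat and h :: "nat \<Rightarrow> nat" and lam :: "nat list"
  assumes "n \<ge> 1"
    and "h ` {1..n} \<subseteq> {0..n - 1}"
    and "mono_on {1..n} h"
    and "\<forall>i\<in>{1..n}. h i < i"
    and "weak_composition lam n"
    and "Hess n (X_mat lam) h \<noteq> {}"
  shows "connectedin (flag_topology n) (Hess n (X_mat lam) h)"
proof -
  interpret hess_diagram n lam h
    using assms by unfold_locales auto
  have "connected_component_of Hess_topology V W"
    if V: "V \<in> Hess n (X_mat lam) h" and W: "W \<in> Hess n (X_mat lam) h" for V W
  proof -
    obtain q where q: "admissible q" "connected_component_of Hess_topology (coord_flag q) V"
      using Hess_contracts_to_coord_flag[OF V] .
    obtain q' where q': "admissible q'" "connected_component_of Hess_topology (coord_flag q') W"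
      using Hess_contracts_to_coord_flag[OF W] .
    have "connected_component_of Hess_topology (coord_flag q) (coord_flag q')"
      \<comment> \<open>Starting at index 1 makes the agreement condition vacuous.\<close>
      by (rule coord_flags_connected[of 1]) (use q(1) q'(1) in auto)
    from connected_component_of_trans[OF this q'(2)] show ?thesis
      by (rule connected_component_of_trans[OF q(2)[THEN connected_component_of_sym[THEN iffD1]]])
  qed
  moreover have "topspace Hess_topology = Hess n (X_mat lam) h"
    by (auto simp: topspace_flag_topology Hess_def)
  ultimately show ?thesis
    using topspace_flag_topology
    by (auto simp: connectedin_def connected_space_iff_connected_component Hess_def)
qed

end
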